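(* Let $(\Omega,\mathcal{F},\mathbb{P})$ be a nonatomic probability space and let $(\Phi,\Psi)$ be an Orlicz pair as in the context. Let $\rho:L^\infty\to(-\infty,\infty]$ be a proper, convex, law-invariant functional with the Fatou property on $L^\infty$ (equivalently, norm lower semicontinuous on $L^\infty$). Then $\rho$ admits a unique extension $\rho':L^\Phi\to(-\infty,\infty]$ (i.e. $\rho'=\rho$ on $L^\infty$) which is proper, convex, law-invariant, and has the Fatou property on $L^\Phi$.
   Context: $(\Omega,\mathcal{F},\mathbb{P})$ is a nonatomic probability space; random variables are identified up to a.s. equality. An Orlicz function is a convex, increasing $\Phi:[0,\infty)\to[0,\infty)$ with $\Phi(0)=0$; its conjugate is $\Psi(s)=\sup_{t\ge0}(ts-\Phi(t))$. Standing assumption: $\Phi(t)>0$ for $t>0$ and $\lim_{t\to\infty}\Phi(t)/t=\infty$. $L^\Phi$ is the space of random variables $X$ with $\|X\|_\Phi:=\inf\{\lambda>0:\mathbb{E}[\Phi(|X|/\lambda)]\le 1\}<\infty$; $L^\infty\subset L^\Phi$. Proper: not identically $\infty$. Law-invariant: $\rho(X)=\rho(Y)$ whenever $X,Y$ have the same law. For $E\in\{L^\infty,L^\Phi\}$, a functional on $E$ has the Fatou property on $E$ if whenever $X_n,X\in E$, $X_n\to X$ a.s. and $|X_n|\le Y$ for some $Y\in E$ and all $n$, then $\rho(X)\le\liminf_n\rho(X_n)$. *)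

theory Defs
  imports "HOL-Probability.Probability"
begin

definition nonatomic :: "'a measure \<Rightarrow> bool" where
  "nonatomic M \<longleftrightarrow> (\<forall>A\<in>sets M. measure M A > 0 \<longrightarrow>
     (\<exists>B\<in>sets M. B \<subseteq> A \<and> 0 < measure M B \<and> measure M B < measure M A))"

definition orlicz_function :: "(real \<Rightarrow> real) \<Rightarrow> bool" where
  "orlicz_function \<Phi> \<longleftrightarrow> convex_on {0..} \<Phi> \<and> mono_on {0..} \<Phi> \<and> \<Phi> 0 = 0
     \<and> (\<forall>t\<ge>0. \<Phi> t \<ge> 0)"

definition standing_orlicz :: "(real \<Rightarrow> real) \<Rightarrow> bool" where
  "standing_orlicz \<Phi> \<longleftrightarrow> orlicz_function \<Phi> \<and> (\<forall>t>0. \<Phi> t > 0)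
     \<and> filterlim (\<lambda>t. \<Phi> t / t) at_top at_top"

definition conjugate :: "(real \<Rightarrow> real) \<Rightarrow> real \<Rightarrow> ereal" where
  "conjugate \<Phi> s = (SUP t\<in>{0..}. ereal (t * s - \<Phi> t))"

definition Linf :: "'a measure \<Rightarrow> ('a \<Rightarrow> real) set" where
  "Linf M = {X. X \<in> borel_measurable M \<and> (\<exists>C. AE x in M. \<bar>X x\<bar> \<le> C)}"

definition LPhi :: "'a measure \<Rightarrow> (real \<Rightarrow> real) \<Rightarrow> ('a \<Rightarrow> real) set" where
  "LPhi M \<Phi> = {X. X \<in> borel_measurable M \<and>
     (\<exists>l>0. (\<integral>\<^sup>+ x. ennreal (\<Phi> (\<bar>X x\<bar> / l)) \<partial>M) \<le> 1)}"

definition proper_on :: "('a \<Rightarrow> real) set \<Rightarrow> (('a \<Rightarrow> real) \<Rightarrow> ereal) \<Rightarrow> bool" where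
  "proper_on E \<rho> \<longleftrightarrow> (\<forall>X\<in>E. \<rho> X \<noteq> -\<infinity>) \<and> (\<exists>X\<in>E. \<rho> X \<noteq> \<infinity>)"

definition convex_fun_on :: "('a \<Rightarrow> real) set \<Rightarrow> (('a \<Rightarrow> real) \<Rightarrow> ereal) \<Rightarrow> bool" where
  "convex_fun_on E \<rho> \<longleftrightarrow> (\<forall>X\<in>E. \<forall>Y\<in>E. \<forall>l::real. 0 \<le> l \<and> l \<le> 1 \<longrightarrow>
     \<rho> (\<lambda>\<omega>. l * X \<omega> + (1 - l) * Y \<omega>) \<le> ereal l * \<rho> X + ereal (1 - l) * \<rho> Y)"

definition law_invariant_on :: "'a measure \<Rightarrow> ('a \<Rightarrow> real) set \<Rightarrow> (('a \<Rightarrow> real) \<Rightarrow> ereal) \<Rightarrow> bool" where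
  "law_invariant_on M E \<rho> \<longleftrightarrow> (\<forall>X\<in>E. \<forall>Y\<in>E.
     distr M borel X = distr M borel Y \<longrightarrow> \<rho> X = \<rho> Y)"

definition fatou_on :: "'a measure \<Rightarrow> ('a \<Rightarrow> real) set \<Rightarrow> (('a \<Rightarrow> real) \<Rightarrow> ereal) \<Rightarrow> bool" where
  "fatou_on M E \<rho> \<longleftrightarrow> (\<forall>Xs X Y. (\<forall>n. Xs n \<in> E) \<and> X \<in> E \<and> Y \<in> E
     \<and> (AE \<omega> in M. (\<lambda>n. Xs n \<omega>) \<longlonglongrightarrow> X \<omega>)
     \<and> (\<forall>n. AE \<omega> in M. \<bar>Xs n \<omega>\<bar> \<le> Y \<omega>)
     \<longrightarrow> \<rho> X \<le> liminf (\<lambda>n. \<rho> (Xs n)))"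

end

theory Submission
  imports Defs "HOL-Real_Asymp.Real_Asymp"
begin

text \<open>
  Averaging a variable \<open>X\<close> over an event \<open>A\<close> decreases every convex law-invariant functional with the
  Fatou property: replacing \<open>X\<close> on \<open>A\<close> by \<open>q (U + j/N mod 1)\<close>, where \<open>U\<close> is uniform on \<open>A\<close> and \<open>q\<close> is the
  quantile function of the law of \<open>X\<close> given \<open>A\<close>, yields \<open>N\<close> variables with the law of \<open>X\<close> whose mean
  is a Riemann sum of the monotone function \<open>q\<close> on \<open>A\<close>. These means converge, dominated along a
  subsequence, to the average. Averaging over the tails \<open>|X| > n\<close> turns \<open>X\<close> into bounded variables
  that converge to \<open>X\<close>, again dominated along a subsequence, so every extension must be
  the supremum over \<open>n\<close> of \<open>\<rho>\<close> at the tail averages. This supremum equals the supremum of \<open>\<rho>\<close> over all finite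
  compositions of averages that cover the space. Such a composition is a linear map into the bounded variables and
  preserves dominated convergence, which gives convexity and the Fatou property of the extension.
\<close>

section \<open>Uniform variables on nonatomic spaces\<close>

text \<open>What survives is modular convergence at one fixed scale: if \<Phi>(|X| / l) is
  integrable, its tails tend to 0 by dominated convergence, and a subsequence with summable modulars
  is dominated by an element of the space, as the Fatou property demands. The functional is not
  assumed monotone, so truncating X may raise its value; averaging over the tail cannot. The tail
  formula alone hides convexity, because the tail event moves with X; averages over a fixed list of
  events are linear in X. Conversely, the supremum over lists hides law invariance, because fixed
  events see more of X than its law, while the law of a tail average depends on the law of X only.
  Hence the two formulas for one extension. Events of a list may overlap, so that appending a tail
  event to a cover gives a cover again and no common refinement is formed.\<close>

abbreviation unif :: "real measure" where
  "unif \<equiv> uniform_measure lborel {0<..<1}"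

lemma prob_space_unif: "prob_space unif"
  by (intro prob_space_uniform_measure) auto

lemma AE_unif: "AE u in unif. 0 < u \<and> u < 1"
  by (intro AE_uniform_measureI) auto

lemma unif_eq_density: "unif = density lborel (indicator {0<..<1})"
  unfolding uniform_measure_def by (intro arg_cong[where f = "density lborel"]) (auto simp: fun_eq_iff divide_ennreal_def)

lemma nn_integral_unif:
  assumes "f \<in> borel_measurable borel"
  shows "(\<integral>\<^sup>+u. f u \<partial>unif) = (\<integral>\<^sup>+u. f u * indicator {0<..<1} u \<partial>lborel)"
  using assms by (simp add: unif_eq_density nn_integral_density mult.commute)

lemma emeasure_unif:
  assumes "B \<in> sets borel"
  shows "emeasure unif B = emeasure lborel (B \<inter> {0<..<1})"
  using assms by (simp add: emeasure_uniform_measure Int_commute divide_ennreal_def)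

text \<open>Rotation cuts the interval at 1 - c and moves the two pieces by the translations c and c
  - 1, each of which preserves Lebesgue measure. The images are the parts of the interval right and
  left of c; the boundary points are null.\<close>

lemma distr_unif_rotate:
  assumes c: "0 \<le> c" "c < 1"
  shows "distr unif borel (\<lambda>u. frac (u + c)) = unif"
proof (rule measure_eqI)
  have [measurable]: "(\<lambda>u::real. frac (u + c)) \<in> borel_measurable borel"
    by (simp add: frac_def)
  fix B assume "B \<in> sets (distr unif borel (\<lambda>u. frac (u + c)))"
  then have B[measurable]: "B \<in> sets borel" by simp
  have shift: "(\<integral>\<^sup>+u. indicator (B \<inter> S) (u + a) \<partial>lborel) = emeasure lborel (B \<inter> S)"
    if [measurable]: "S \<in> sets borel" for S :: "real set" and a
    using nn_integral_real_affine[of "indicator (B \<inter> S)" 1 a] by (simp add: add.commute)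
  have AE1: "AE u in lborel. u \<noteq> 1 - c" "AE u in lborel. u \<noteq> c" "AE u in lborel. u \<noteq> 0"
    by (auto intro: AE_lborel_singleton)
  have "emeasure (distr unif borel (\<lambda>u. frac (u + c))) B
      = (\<integral>\<^sup>+u. indicator B (frac (u + c)) * indicator {0<..<1} u \<partial>lborel)"
    by (simp add: nn_integral_indicator[symmetric] nn_integral_distr nn_integral_unif del: nn_integral_indicator)
  also have "\<dots> = (\<integral>\<^sup>+u. indicator (B \<inter> {c<..<1}) (u + c) + indicator (B \<inter> {0<..<c}) (u + (c - 1)) \<partial>lborel)"
  proof (intro nn_integral_cong_AE)
    show "AE u in lborel. indicator B (frac (u + c)) * indicator {0<..<1} u
        = (indicator (B \<inter> {c<..<1}) (u + c) + indicator (B \<inter> {0<..<c}) (u + (c - 1)) :: ennreal)"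
      using AE1
    proof eventually_elim
      case (elim u)
      have "frac (u + c) = u + c" if "0 < u" "u + c < 1"
        using that c by (simp add: frac_eq)
      moreover have "frac (u + c) = u + (c - 1)" if "u < 1" "u + c > 1"
        using that c frac_1_eq[of "u + c - 1"] by (auto simp: frac_eq)
      moreover have "u + c < 1 \<or> u + c > 1"
        using elim by linarith
      ultimately show ?case
        using elim c by (cases "0 < u \<and> u < 1") (auto simp: indicator_def)
    qed
  qed
  also have "\<dots> = emeasure lborel (B \<inter> {c<..<1}) + emeasure lborel (B \<inter> {0<..<c})"
    by (subst nn_integral_add) (auto simp: shift)
  also have "\<dots> = emeasure lborel ((B \<inter> {c<..<1}) \<union> (B \<inter> {0<..<c}))"
    by (intro plus_emeasure) auto
  also have "\<dots> = emeasure lborel (B \<inter> {0<..<1})"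
  proof (intro emeasure_eq_AE)
    show "AE u in lborel. (u \<in> (B \<inter> {c<..<1}) \<union> (B \<inter> {0<..<c})) = (u \<in> B \<inter> {0<..<1})"
      using AE1(2) by eventually_elim (use c in auto)
  qed auto
  finally show "emeasure (distr unif borel (\<lambda>u. frac (u + c))) B = emeasure unif B"
    by (simp add: emeasure_unif[OF B])
qed simp

lemma quantile_exists:
  assumes "real_distribution D"
  obtains q where "q \<in> borel_measurable borel" "mono_on {0<..<1} q" "distr unif borel q = D"
proof -
  interpret D: cdf_distribution D
    using assms by (simp add: cdf_distribution_def)
  \<comment> \<open>\<open>D.I\<close> is the generalised inverse of the distribution function, used
    on the open unit interval only. The value 0 elsewhere is a default that makes \<open>q\<close>
    measurable on the whole line; \<open>unif\<close> does not see it.\<close>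
  define q where "q u = (if u \<in> {0<..<1} then D.I u else 0)" for u :: real
  have q[measurable]: "q \<in> borel_measurable borel"
    unfolding q_def using D.measurable_CI
    by (subst measurable_restrict_space_iff[symmetric]) auto
  moreover have "mono_on {0<..<1} q"
    using D.mono_I by (auto simp: mono_on_def q_def)
  moreover have "distr unif borel q = D"
  proof (rule measure_eqI)
    fix B assume "B \<in> sets (distr unif borel q)"
    then have B[measurable]: "B \<in> sets borel" by simp
    have CI: "D.I \<in> borel_measurable (restrict_space lborel {0<..<1})"
      using D.measurable_CI
      by (simp add: measurable_cong_sets[OF sets_restrict_space_cong[OF sets_lborel] refl])
    have "emeasure D B = emeasure (distr (restrict_space lborel {0<..<1::real}) borel D.I) B"
      by (simp add: D.distr_I_eq_M)
    also have "\<dots> = emeasure (restrict_space lborel {0<..<1::real}) (D.I -` B \<inter> {0<..<1})"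
      using CI by (subst emeasure_distr) (auto simp: space_restrict_space)
    also have "\<dots> = emeasure lborel (q -` B \<inter> {0<..<1})"
      by (subst emeasure_restrict_space) (auto simp: q_def intro!: arg_cong[where f = "emeasure lborel"])
    also have "\<dots> = emeasure (distr unif borel q) B"
      using measurable_sets[OF q B] by (subst emeasure_distr) (auto simp: emeasure_unif simp del: emeasure_uniform_measure)
    finally show "emeasure (distr unif borel q) B = emeasure D B" by simp
  qed simp
  ultimately show ?thesis by (rule that)
qed

section \<open>Nonatomic spaces: events of prescribed probability and a uniform variable\<close>

lemma (in prob_space) nonatomic_small_subset:
  assumes na: "nonatomic M" and A: "A \<in> events" "prob A > 0" and e: "e > 0"
  obtains B where "B \<in> events" "B \<subseteq> A" "0 < prob B" "prob B < e"
proof -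
  \<comment> \<open>Of \<open>B\<close> and \<open>A - B\<close>, both of positive probability, one
    has at most half the probability of \<open>A\<close>.\<close>
  have half: "\<exists>B\<in>events. B \<subseteq> A \<and> 0 < prob B \<and> prob B \<le> prob A / 2"
    if A: "A \<in> events" "prob A > 0" for A
  proof -
    obtain B where B: "B \<in> events" "B \<subseteq> A" "0 < prob B" "prob B < prob A"
      using na A unfolding nonatomic_def by blast
    then have "prob (A - B) = prob A - prob B"
      using A by (intro finite_measure_Diff) auto
    then have "0 < prob (A - B)" "prob B \<le> prob A / 2 \<or> prob (A - B) \<le> prob A / 2"
      using B by auto
    then show ?thesis
      using A B by (meson Diff_subset sets.Diff)
  qed
  have "\<exists>B\<in>events. B \<subseteq> A \<and> 0 < prob B \<and> prob B \<le> prob A / 2 ^ n" for n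
  proof (induction n)
    case 0
    then show ?case using A by auto
  next
    case (Suc n)
    then obtain B where B: "B \<in> events" "B \<subseteq> A" "0 < prob B" "prob B \<le> prob A / 2 ^ n"
      by blast
    with half[of B] obtain C where C: "C \<in> events" "C \<subseteq> B" "0 < prob C" "prob C \<le> prob B / 2"
      by blast
    have "prob C \<le> prob A / 2 ^ Suc n"
      using C(4) divide_right_mono[OF B(4), of 2] by simp
    with B C show ?case by blast
  qed
  note small = this
  obtain n where "(1 / 2 :: real) ^ n < e"
    using real_arch_pow_inv[OF e, of "1 / 2"] by auto
  moreover have "prob A / 2 ^ n \<le> (1 / 2) ^ n"
    by (simp add: power_divide divide_right_mono)
  ultimately show ?thesis
    using small[of n] that by force
qed

text \<open>Sierpinski's intermediate value property, by greedy exhaustion: each stage enlarges the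
  current event to within 2^-n of the best admissible enlargement. If the union still fell short of
  t, a small piece C of the remainder could be added to it without exceeding t, and greediness would
  force prob C below every 2^-n.\<close>

lemma (in prob_space) nonatomic_subset_of_prob:
  assumes na: "nonatomic M" and A: "A \<in> events" and t: "0 \<le> t" "t \<le> prob A"
  obtains B where "B \<in> events" "B \<subseteq> A" "prob B = t"
proof -
  define P where "P B \<longleftrightarrow> B \<in> events \<and> B \<subseteq> A \<and> prob B \<le> t" for B
  have "\<exists>B. \<forall>n::nat. P (B n) \<and>
      (B n \<subseteq> B (Suc n) \<and> (\<forall>D. P D \<and> B n \<subseteq> D \<longrightarrow> prob D \<le> prob (B (Suc n)) + (1 / 2) ^ n))"
  proof (rule dependent_nat_choice)
    show "\<exists>B. P B" using t by (auto simp: P_def intro!: exI[of _ "{}"])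
  next
    fix B and n :: nat assume PB: "P B"
    let ?S = "prob ` {D. P D \<and> B \<subseteq> D}"
    have "bdd_above ?S" by (auto simp: P_def intro!: bdd_aboveI[of _ t])
    moreover have "?S \<noteq> {}" using PB by blast
    ultimately have "\<exists>x\<in>?S. Sup ?S - (1 / 2) ^ n < x"
      by (subst less_cSup_iff[symmetric]) auto
    then obtain C where "P C" "B \<subseteq> C" "Sup ?S - (1 / 2) ^ n < prob C"
      by blast
    moreover have "prob D \<le> Sup ?S" if "P D" "B \<subseteq> D" for D
      using that \<open>bdd_above ?S\<close> by (intro cSup_upper) auto
    ultimately show "\<exists>C. P C \<and> (B \<subseteq> C \<and> (\<forall>D. P D \<and> B \<subseteq> D \<longrightarrow> prob D \<le> prob C + (1 / 2) ^ n))"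
      by (intro exI[of _ C]) force
  qed
  then obtain B where PB: "\<And>n. P (B n)" and inc: "\<And>n::nat. B n \<subseteq> B (Suc n)"
    and greedy: "\<And>n D. P D \<Longrightarrow> B n \<subseteq> D \<Longrightarrow> prob D \<le> prob (B (Suc n)) + (1 / 2) ^ n"
    by metis
  let ?B = "\<Union>n. B n"
  have B: "?B \<in> events" "?B \<subseteq> A"
    using PB by (auto simp: P_def)
  have "(\<lambda>n. prob (B n)) \<longlonglongrightarrow> prob ?B"
    using PB inc by (intro finite_Lim_measure_incseq) (auto simp: P_def incseq_Suc_iff)
  then have le: "prob ?B \<le> t"
    by (rule LIMSEQ_le_const2) (use PB in \<open>auto simp: P_def\<close>)
  have "prob ?B = t"
  proof (rule ccontr)
    assume "prob ?B \<noteq> t"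
    with le have lt: "prob ?B < t" by simp
    have "prob (A - ?B) = prob A - prob ?B"
      using A B by (intro finite_measure_Diff) auto
    with lt t have "prob (A - ?B) > 0" by simp
    then obtain C where C: "C \<in> events" "C \<subseteq> A - ?B" "0 < prob C" "prob C < t - prob ?B"
      using nonatomic_small_subset[OF na, of "A - ?B" "t - prob ?B"] A B lt by auto
    have un: "prob (?B \<union> C) = prob ?B + prob C"
      using B C by (intro finite_measure_Union) auto
    with C B have PBC: "P (?B \<union> C)" by (auto simp: P_def)
    have "prob C \<le> (1 / 2) ^ n" for n
    proof -
      have "prob (?B \<union> C) \<le> prob (B (Suc n)) + (1 / 2) ^ n"
        by (intro greedy PBC) auto
      also have "prob (B (Suc n)) \<le> prob ?B"
        using B by (intro finite_measure_mono) auto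
      finally show ?thesis using un by simp
    qed
    moreover obtain n where "(1 / 2 :: real) ^ n < prob C"
      using real_arch_pow_inv[OF C(3), of "1 / 2"] by auto
    ultimately show False by (meson not_le)
  qed
  with B show ?thesis by (rule that)
qed

text \<open>A dyadic scale of nested events, \<open>C n k\<close> of probability k / 2^n, prescribes
  the sublevel sets of the variable: \<open>C n k\<close> lies between the events where it is below
  k / 2^n and where it is at most k / 2^n. The variable is recovered at a point as the supremum of
  the levels whose event misses that point.\<close>

lemma (in prob_space) nonatomic_uniform:
  assumes na: "nonatomic M"
  obtains U where "U \<in> borel_measurable M" "distr M borel U = unif"
proof -
  define P where "P n C \<longleftrightarrow> (\<forall>k\<le>2 ^ n. C k \<in> events \<and> prob (C k) = real k / 2 ^ n) \<and>
      (\<forall>k<2 ^ n. C k \<subseteq> C (Suc k))" for n :: nat and C :: "nat \<Rightarrow> 'a set"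
  have "\<exists>C. \<forall>n. P n (C n) \<and> (\<forall>k. C (Suc n) (2 * k) = C n k)"
  proof (rule dependent_nat_choice)
    show "\<exists>C. P 0 C"
      by (intro exI[of _ "\<lambda>k. if k = 0 then {} else space M"]) (auto simp: P_def prob_space le_Suc_eq)
  next
    fix C n assume C: "P n C"
    have "\<exists>B. B \<in> events \<and> B \<subseteq> C (Suc k) - C k \<and> prob B = 1 / 2 ^ Suc n" if k: "k < 2 ^ n" for k
    proof -
      have ev: "C (Suc k) \<in> events" "C k \<in> events" and sub: "C k \<subseteq> C (Suc k)"
        and pr: "prob (C (Suc k)) = real (Suc k) / 2 ^ n" "prob (C k) = real k / 2 ^ n"
        using C k by (auto simp: P_def)
      have "prob (C (Suc k) - C k) = 1 / 2 ^ n"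
        using finite_measure_Diff[OF ev sub] pr by (simp add: field_simps)
      then have "1 / 2 ^ Suc n \<le> prob (C (Suc k) - C k)" by (simp add: divide_left_mono)
      moreover have "C (Suc k) - C k \<in> events" using ev by blast
      moreover have "(0 :: real) \<le> 1 / 2 ^ Suc n" by simp
      ultimately show ?thesis
        using nonatomic_subset_of_prob[OF na] by metis
    qed
    then obtain h where h: "\<And>k. k < 2 ^ n \<Longrightarrow> h k \<in> events"
        "\<And>k. k < 2 ^ n \<Longrightarrow> h k \<subseteq> C (Suc k) - C k" "\<And>k. k < 2 ^ n \<Longrightarrow> prob (h k) = 1 / 2 ^ Suc n"
      by metis
    \<comment> \<open>Even indices keep the old events; each odd index inserts an event that takes
      half of the increment between two neighbours.\<close>
    define C' where "C' k = (if even k then C (k div 2) else C (k div 2) \<union> h (k div 2))" for k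
    have "P (Suc n) C'"
      unfolding P_def
    proof (intro conjI allI impI)
      fix k :: nat assume k: "k \<le> 2 ^ Suc n"
      show "C' k \<in> events"
        using k C h(1)[of "k div 2"] by (auto simp: C'_def P_def elim!: oddE)
      show "prob (C' k) = real k / 2 ^ Suc n"
      proof (cases "even k")
        case True
        then show ?thesis using C k by (auto simp: C'_def P_def elim!: evenE)
      next
        case False
        then obtain l where l: "k = 2 * l + 1" by (elim oddE)
        with k have l2: "l < 2 ^ n" by simp
        have "prob (C l \<union> h l) = prob (C l) + prob (h l)"
          using h[OF l2] C l2 by (intro finite_measure_Union) (auto simp: P_def)
        then show ?thesis
          using l l2 h(3)[OF l2] C by (simp add: C'_def P_def field_simps)
      qed
    next
      fix k :: nat assume k: "k < 2 ^ Suc n"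
      show "C' k \<subseteq> C' (Suc k)"
      proof (cases "even k")
        case True
        then show ?thesis by (auto simp: C'_def)
      next
        case False
        then obtain l where l: "k = 2 * l + 1" by (elim oddE)
        with k have l2: "l < 2 ^ n" by simp
        then show ?thesis
          using l h(2)[OF l2] C by (auto simp: C'_def P_def)
      qed
    qed
    then show "\<exists>C'. P (Suc n) C' \<and> (\<forall>k. C' (2 * k) = C k)"
      by (intro exI[of _ C']) (auto simp: C'_def)
  qed
  then obtain C where PC: "\<And>n. P n (C n)" and refine1: "\<And>n k. C (Suc n) (2 * k) = C n k"
    by metis
  have refine: "C (n + d) (2 ^ d * k) = C n k" for n d k
    by (induction d) (simp_all add: refine1 mult.assoc)
  have mono_lvl: "C n k \<subseteq> C n l" if "k \<le> l" "l \<le> 2 ^ n" for n k l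
    using that
  proof (induction l rule: dec_induct)
    case (step l)
    then have "C n l \<subseteq> C n (Suc l)"
      using PC[of n] by (simp add: P_def)
    with step show ?case by auto
  qed simp
  \<comment> \<open>Events of different levels are compared at level n + m, where both indices have
    the denominator 2^(n + m).\<close>
  have mono: "C n k \<subseteq> C m l" if le: "real k / 2 ^ n \<le> real l / 2 ^ m" and l: "l \<le> 2 ^ m" for n m k l
  proof -
    have "real (2 ^ m * k) \<le> real (2 ^ n * l)"
      using le by (simp add: field_simps)
    then have "2 ^ m * k \<le> 2 ^ n * l"
      by (simp only: of_nat_le_iff)
    then have "C (n + m) (2 ^ m * k) \<subseteq> C (n + m) (2 ^ n * l)"
      using l by (intro mono_lvl) (auto simp: power_add)
    then show ?thesis
      using refine[of n m k] refine[of m n l] by (simp add: add.commute)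
  qed
  have ev: "C n k \<in> events" and pr: "prob (C n k) = real k / 2 ^ n" if "k \<le> 2 ^ n" for n k
    using PC that by (auto simp: P_def)
  define S where "S w = {real k / 2 ^ n | k n. k \<le> 2 ^ n \<and> w \<notin> C n k}" for w
  define U where "U w = Sup (S w)" for w
  have S01: "S w \<subseteq> {0..1}" for w
    by (auto simp: S_def)
  have bdd: "bdd_above (S w)" for w
    using S01[of w] by (intro bdd_aboveI[of _ 1]) auto
  have "C 0 0 \<in> events" "prob (C 0 0) = 0"
    using ev[of 0 0] pr[of 0 0] by auto
  \<comment> \<open>On the null event \<open>C 0 0\<close> no level is missed, so \<open>S w\<close>
    is empty and its supremum is meaningless; there the value is set to 0.\<close>
  define V where "V w = (if w \<in> C 0 0 then 0 else U w)" for w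
  have Snz: "S w \<noteq> {}" if "w \<notin> C 0 0" for w
    using that by (auto simp: S_def intro!: exI[of _ 0])
  \<comment> \<open>A strict lower bound turns the supremum into an existential statement, so the
    event is a countable union.\<close>
  have gt: "{w \<in> space M. x < V w} = (\<Union>(n, k) \<in> {(n, k). k \<le> 2 ^ n \<and> x < real k / 2 ^ n}. space M - C n k)"
    if "0 \<le> x" for x
  proof -
    have "C 0 0 \<subseteq> C n k" if "k \<le> 2 ^ n" for n k
      using that by (intro mono) auto
    moreover have "x < U w \<longleftrightarrow> (\<exists>s\<in>S w. x < s)" if "w \<notin> C 0 0" for w
      unfolding U_def using Snz[OF that] bdd by (intro less_cSup_iff)
    ultimately show ?thesis
      using \<open>0 \<le> x\<close> by (auto simp: V_def S_def split: if_splits)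
  qed
  have V01: "0 \<le> V w" "V w \<le> 1" for w
  proof -
    have "0 \<le> U w \<and> U w \<le> 1" if w: "w \<notin> C 0 0"
    proof
      show "U w \<le> 1" unfolding U_def using S01[of w] Snz[OF w] by (intro cSup_least) auto
      obtain s where "s \<in> S w" using Snz[OF w] by blast
      then show "0 \<le> U w" unfolding U_def using S01[of w] bdd
        by (intro cSup_upper2[of s]) auto
    qed
    then show "0 \<le> V w" "V w \<le> 1" by (auto simp: V_def)
  qed
  have meas: "{w \<in> space M. x < V w} \<in> events" if "0 \<le> x" for x
    unfolding gt[OF that]
    by (rule sets.countable_UN'') (use ev in \<open>auto intro!: sets.compl_sets countable_subset[OF subset_UNIV]\<close>)
  have V: "V \<in> borel_measurable M"
  proof (subst borel_measurable_iff_greater, intro allI)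
    fix x
    show "{w \<in> space M. x < V w} \<in> events"
    proof (cases "0 \<le> x")
      case True
      then show ?thesis by (rule meas)
    next
      case False
      then have "{w \<in> space M. x < V w} = space M"
        using V01(1) by (auto intro: less_le_trans[of x 0])
      then show ?thesis by simp
    qed
  qed
  have tail: "prob {w \<in> space M. x < V w} = 1 - x" if x: "0 \<le> x" "x < 1" for x
  proof -
    have "\<bar>prob {w \<in> space M. x < V w} - (1 - x)\<bar> \<le> (1 / 2) ^ n" for n
    proof -
      \<comment> \<open>The dyadic neighbours of x at level n: missing \<open>C n (Suc k)\<close>
        forces \<open>V\<close> above x, and \<open>V\<close> above x forces missing
        \<open>C n k\<close>. The two probabilities differ by 2^-n.\<close>
      define k where "k = nat \<lfloor>x * 2 ^ n\<rfloor>"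
      have k: "real k \<le> x * 2 ^ n" "x * 2 ^ n < real k + 1"
        using x by (auto simp: k_def)
      have "real k < 2 ^ n"
        using k(1) x by (smt (verit) mult_less_cancel_right2 zero_less_power)
      then have k2: "Suc k \<le> 2 ^ n"
        by (metis Suc_leI of_nat_less_iff of_nat_numeral of_nat_power)
      have "1 - real (Suc k) / 2 ^ n = prob (space M - C n (Suc k))"
        using pr[OF k2] by (simp add: prob_compl[OF ev[OF k2]])
      also have "\<dots> \<le> prob {w \<in> space M. x < V w}"
      proof (intro finite_measure_mono meas x(1))
        have "x < real (Suc k) / 2 ^ n" using k by (simp add: field_simps)
        with k2 show "space M - C n (Suc k) \<subseteq> {w \<in> space M. x < V w}"
          unfolding gt[OF x(1)] by (intro order_trans[OF _ UN_upper[of "(n, Suc k)"]]) auto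
      qed
      finally have "1 - real (Suc k) / 2 ^ n \<le> prob {w \<in> space M. x < V w}" .
      have kx: "real k / 2 ^ n \<le> x" using k by (simp add: field_simps)
      have k2': "k \<le> 2 ^ n" using k2 by simp
      have "{w \<in> space M. x < V w} \<subseteq> space M - C n k"
        unfolding gt[OF x(1)]
      proof safe
        fix w m l assume "w \<in> C n k" "w \<notin> C m l" "l \<le> 2 ^ m" "x < real l / 2 ^ m"
        then show False using mono[of k n l m] kx by auto
      qed
      then have "prob {w \<in> space M. x < V w} \<le> prob (space M - C n k)"
        using ev[OF k2'] by (intro finite_measure_mono) auto
      also have "\<dots> = 1 - real k / 2 ^ n"
        using pr[OF k2'] by (simp add: prob_compl[OF ev[OF k2']])
      finally have "prob {w \<in> space M. x < V w} \<le> 1 - real k / 2 ^ n" .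
      moreover have "x \<le> real (Suc k) / 2 ^ n"
        using k by (simp add: field_simps)
      moreover have "real (Suc k) / 2 ^ n = real k / 2 ^ n + (1 / 2) ^ n"
        by (simp add: field_simps)
      ultimately show ?thesis
        using kx \<open>1 - real (Suc k) / 2 ^ n \<le> _\<close> by linarith
    qed
    then have "(\<lambda>n. \<bar>prob {w \<in> space M. x < V w} - (1 - x)\<bar>) \<longlonglongrightarrow> 0"
      by (intro tendsto_sandwich[OF _ _ tendsto_const LIMSEQ_power_zero[of "1 / 2 :: real"]]) auto
    then show ?thesis by (simp add: LIMSEQ_const_iff)
  qed
  have "distr M borel V = unif"
  proof (rule measure_eqI_lessThan)
    fix x :: real
    have eq: "emeasure (distr M borel V) {x<..} = prob {w \<in> space M. x < V w}"
      using V by (subst emeasure_distr) (auto simp: emeasure_eq_measure intro!: arg_cong[where f = prob])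
    show "emeasure (distr M borel V) {x<..} < \<infinity>" unfolding eq by simp
    have "x < 0 \<or> 0 \<le> x \<and> x < 1 \<or> 1 \<le> x" by linarith
    then show "emeasure (distr M borel V) {x<..} = emeasure unif {x<..}"
    proof (elim disjE conjE)
      assume "x < 0"
      then have "{w \<in> space M. x < V w} = space M" "{x<..} \<inter> {0<..<1} = {0<..<1}"
        using V01(1) by (auto intro: less_le_trans[of x 0])
      then show ?thesis unfolding eq by (simp add: emeasure_unif prob_space Int_commute del: emeasure_uniform_measure)
    next
      assume x: "0 \<le> x" "x < 1"
      then have "{x<..} \<inter> {0<..<1} = {x<..<1}" by auto
      then show ?thesis unfolding eq using x by (simp add: emeasure_unif tail del: emeasure_uniform_measure)
    next
      assume "1 \<le> x"
      then have "{w \<in> space M. x < V w} = {}" "{x<..} \<inter> {0<..<1} = {}"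
        using order_trans[OF V01(2)] by (auto simp: not_less)
      then show ?thesis unfolding eq by (simp add: emeasure_unif \<open>{w \<in> space M. x < V w} = {}\<close> del: emeasure_uniform_measure Collect_empty_eq)
    qed
  qed auto
  with V show ?thesis by (rule that)
qed

section \<open>Orlicz spaces\<close>

lemma sum_frac_rotations:
  fixes g :: "real \<Rightarrow> real"
  assumes u: "0 \<le> u" "u < 1" and N: "N > 0"
  shows "(\<Sum>j<N. g (frac (u + real j / real N))) = (\<Sum>k<N. g ((real k + frac (real N * u)) / real N))"
proof -
  define i where "i = nat \<lfloor>real N * u\<rfloor>"
  define \<theta> where "\<theta> = frac (real N * u)"
  have Nu: "real N * u = real i + \<theta>"
    using u by (simp add: i_def \<theta>_def frac_def)
  have \<theta>: "0 \<le> \<theta>" "\<theta> < 1"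
    by (auto simp: \<theta>_def frac_lt_1)
  have u_eq: "u = (real i + \<theta>) / real N"
    using Nu N by (simp add: field_simps)
  \<comment> \<open>The rotations of u by multiples of 1 / N are the N points of the half-open unit
    interval congruent to u modulo 1 / N; in increasing order the j-th rotation has index (i + j)
    mod N.\<close>
  have step: "frac (u + real j / real N) = (real ((i + j) mod N) + \<theta>) / real N" for j
  proof -
    have "real (i + j) = real (N * ((i + j) div N) + (i + j) mod N)"
      by simp
    then have "u + real j / real N = (real ((i + j) mod N) + \<theta>) / real N + of_int (int ((i + j) div N))"
      using N unfolding u_eq of_nat_add of_nat_mult by (simp add: field_simps)
    then have "frac (u + real j / real N) = frac ((real ((i + j) mod N) + \<theta>) / real N)"
      by (simp only: frac_add_of_int_right)
    moreover have "real ((i + j) mod N) + 1 \<le> real N"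
      using mod_less_divisor[OF N, of "i + j"] by linarith
    ultimately show ?thesis
      using \<theta> N by (simp add: frac_eq)
  qed
  have inj: "inj_on (\<lambda>j. (i + j) mod N) {..<N}"
  proof (rule inj_onI)
    fix j k assume "j \<in> {..<N}" "k \<in> {..<N}" "(i + j) mod N = (i + k) mod N"
    then show "j = k"
    proof (induction j k rule: linorder_wlog)
      case (le j k)
      then have "N dvd (i + k) - (i + j)"
        using mod_eq_dvd_iff_nat[of "i + j" "i + k" N] by simp
      then have "N dvd k - j" by simp
      moreover have "k - j < N" using le by auto
      ultimately show ?case using le by (auto dest: dvd_imp_le)
    qed (auto dest: sym)
  qed
  have "(\<lambda>j. (i + j) mod N) ` {..<N} = {..<N}"
    using N by (intro card_subset_eq) (auto simp: card_image[OF inj])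
  with inj have "bij_betw (\<lambda>j. (i + j) mod N) {..<N} {..<N}"
    by (simp add: bij_betw_def)
  from sum.reindex_bij_betw[OF this, of "\<lambda>k. g ((real k + \<theta>) / real N)"]
  show ?thesis
    by (simp add: step \<theta>_def)
qed

text \<open>In increasing order, the k-th sample point of u lies to the left of the (k+1)-st sample
  point of v, whatever the two offsets are. After a shift by one, monotonicity compares the sums
  term by term. Only the last term for u and the first for v stay unmatched, and each costs at most
  K; the total 2 * K does not depend on N.\<close>

lemma rotation_average_oscillation:
  fixes g :: "real \<Rightarrow> real"
  assumes g: "mono_on {0..<1} g" "\<And>x. \<bar>g x\<bar> \<le> K"
    and u: "0 \<le> u" "u < 1" and v: "0 \<le> v" "v < 1" and N: "N > 0"
  shows "(\<Sum>j<N. g (frac (u + real j / real N))) \<le> (\<Sum>j<N. g (frac (v + real j / real N))) + 2 * K"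
proof -
  obtain m where m: "N = Suc m" using N by (cases N) auto
  have le: "g ((real k + frac a) / real N) \<le> g ((real (Suc k) + frac b) / real N)" if "k < m" for k and a b :: real
  proof (rule mono_onD[OF g(1)])
    have k: "real k + 2 \<le> real N" using that m by simp
    show "(real k + frac a) / real N \<in> {0..<1}" "(real (Suc k) + frac b) / real N \<in> {0..<1}"
      using k N frac_lt_1[of a] frac_lt_1[of b] by auto
    have "frac a \<le> 1 + frac b"
      using frac_lt_1[of a] frac_ge_0[of b] by linarith
    then show "(real k + frac a) / real N \<le> (real (Suc k) + frac b) / real N"
      using N by (intro divide_right_mono) auto
  qed
  let ?s = "\<lambda>w k. g ((real k + frac (real N * w)) / real N)"
  have "(\<Sum>k<N. ?s u k) = (\<Sum>k<m. ?s u k) + ?s u m"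
    by (simp add: m)
  also have "\<dots> \<le> (\<Sum>k<m. ?s v (Suc k)) + K"
    using g(2)[of "(real m + frac (real N * u)) / real N"]
    by (intro add_mono sum_mono le) auto
  also have "\<dots> = (\<Sum>k<N. ?s v k) - ?s v 0 + K"
    unfolding m sum.lessThan_Suc_shift by simp
  also have "\<dots> \<le> (\<Sum>k<N. ?s v k) + 2 * K"
    using g(2)[of "(real 0 + frac (real N * v)) / real N"] by simp
  finally show ?thesis
    using u v N by (simp add: sum_frac_rotations)
qed

text \<open>Dominated convergence with f as its own majorant. The integrand is kept apart from the
  variable that cuts the tail because the tails of one variable are needed both for its modular and
  for its absolute value.\<close>

lemma tendsto_nn_integral_tail:
  fixes f :: "'a \<Rightarrow> ennreal" and q :: "'a \<Rightarrow> real" and a :: "nat \<Rightarrow> real"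
  assumes [measurable]: "f \<in> borel_measurable M" "q \<in> borel_measurable M"
    and fin: "(\<integral>\<^sup>+x. f x \<partial>M) < \<infinity>" and a: "filterlim a at_top sequentially"
  shows "(\<lambda>n. \<integral>\<^sup>+x. f x * indicator {x. a n < \<bar>q x\<bar>} x \<partial>M) \<longlonglongrightarrow> 0"
proof -
  have "(\<lambda>n. \<integral>\<^sup>+x. f x * indicator {x. a n < \<bar>q x\<bar>} x \<partial>M) \<longlonglongrightarrow> (\<integral>\<^sup>+x. 0 \<partial>M)"
  proof (rule nn_integral_dominated_convergence[where w = f])
    show "AE x in M. (\<lambda>n. f x * indicator {x. a n < \<bar>q x\<bar>} x) \<longlonglongrightarrow> 0"
    proof (intro AE_I2 tendsto_eventually)
      fix x
      show "\<forall>\<^sub>F n in sequentially. f x * indicator {x. a n < \<bar>q x\<bar>} x = 0"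
        using a[THEN filterlim_at_top[THEN iffD1], rule_format, of "\<bar>q x\<bar>"]
        by eventually_elim auto
    qed
  qed (use fin in \<open>auto split: split_indicator\<close>)
  then show ?thesis by simp
qed

section \<open>Elementary estimates for \<Phi> and membership in the Orlicz space\<close>

locale orlicz =
  fixes \<Phi> :: "real \<Rightarrow> real"
  assumes standing: "standing_orlicz \<Phi>"
begin

lemma convex: "convex_on {0..} \<Phi>" and zero[simp]: "\<Phi> 0 = 0"
  and nonneg: "0 \<le> t \<Longrightarrow> 0 \<le> \<Phi> t" and pos: "0 < t \<Longrightarrow> 0 < \<Phi> t"
  and superlinear: "filterlim (\<lambda>t. \<Phi> t / t) at_top at_top"
  using standing by (auto simp: standing_orlicz_def orlicz_function_def)

lemma mono: "0 \<le> s \<Longrightarrow> s \<le> t \<Longrightarrow> \<Phi> s \<le> \<Phi> t"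
  using standing by (auto simp: standing_orlicz_def orlicz_function_def mono_on_def)

lemma mono_abs: "\<bar>x\<bar> \<le> \<bar>y\<bar> \<Longrightarrow> 0 < l \<Longrightarrow> \<Phi> (\<bar>x\<bar> / l) \<le> \<Phi> (\<bar>y\<bar> / l)"
  by (intro mono divide_right_mono) auto

lemma scale_le: "0 \<le> a \<Longrightarrow> a \<le> 1 \<Longrightarrow> 0 \<le> t \<Longrightarrow> \<Phi> (a * t) \<le> a * \<Phi> t"
  using convex_onD[OF convex, of "a" 0 t] by simp

lemma midpoint_le:
  assumes "0 \<le> s" "0 \<le> t" shows "\<Phi> ((s + t) / 2) \<le> \<Phi> s + \<Phi> t"
proof -
  have "\<Phi> ((1 - 1 / 2) *\<^sub>R s + (1 / 2) *\<^sub>R t) \<le> (1 - 1 / 2) * \<Phi> s + 1 / 2 * \<Phi> t"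
    using assms by (intro convex_onD[OF convex]) auto
  with nonneg[OF assms(1)] nonneg[OF assms(2)] show ?thesis
    by (simp add: field_simps)
qed

text \<open>The substitute for the triangle inequality: the modular is subadditive at the price of
  doubling the scale. This is the source of every later \<open>2 * l\<close>.\<close>

lemma abs_add_le:
  assumes "0 < l"
  shows "\<Phi> (\<bar>x + y\<bar> / (2 * l)) \<le> \<Phi> (\<bar>x\<bar> / l) + \<Phi> (\<bar>y\<bar> / l)"
proof -
  have "\<Phi> (\<bar>x + y\<bar> / (2 * l)) \<le> \<Phi> ((\<bar>x\<bar> / l + \<bar>y\<bar> / l) / 2)"
    using assms by (intro mono) (auto simp: field_simps)
  also have "\<dots> \<le> \<Phi> (\<bar>x\<bar> / l) + \<Phi> (\<bar>y\<bar> / l)"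
    using assms by (intro midpoint_le) auto
  finally show ?thesis .
qed

text \<open>\<Phi> is controlled on the nonnegative half-line only; composing it with
  \<open>max 0\<close> gives a function monotone on the whole line, hence Borel.\<close>

lemma measurable_Phi[measurable]:
  assumes "f \<in> borel_measurable M" "0 < l"
  shows "(\<lambda>x. \<Phi> (\<bar>f x\<bar> / l)) \<in> borel_measurable M"
proof -
  have "mono (\<lambda>t. \<Phi> (max 0 t))"
    by (auto simp: mono_def intro!: mono)
  from borel_measurable_mono[OF this]
  have "(\<lambda>x. \<Phi> (max 0 (\<bar>f x\<bar> / l))) \<in> borel_measurable M"
    by (rule measurable_compose[rotated]) (use assms in measurable)
  with assms(2) show ?thesis by (simp add: max_def)
qed

lemma tendsto_at_zero:
  fixes a :: "nat \<Rightarrow> real"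
  assumes a: "a \<longlonglongrightarrow> 0" and nn: "\<And>n. 0 \<le> a n"
  shows "(\<lambda>n. \<Phi> (a n)) \<longlonglongrightarrow> 0"
proof (rule tendsto_sandwich[OF _ _ tendsto_const])
  show "\<forall>\<^sub>F n in sequentially. 0 \<le> \<Phi> (a n)"
    using nn nonneg by simp
  have "\<forall>\<^sub>F n in sequentially. a n < 1"
    using order_tendstoD(2)[OF a, of 1] by simp
  then show "\<forall>\<^sub>F n in sequentially. \<Phi> (a n) \<le> a n * \<Phi> 1"
    by eventually_elim (use scale_le[of _ 1] nn in force)
  show "(\<lambda>n. a n * \<Phi> 1) \<longlonglongrightarrow> 0"
    using tendsto_mult_right[OF a, of "\<Phi> 1"] by simp
qed

text \<open>Superlinear growth yields t \<le> \<Phi> t for large t, and the constant absorbs the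
  small t. This is what makes the elements of the Orlicz space integrable, so that their averages
  make sense.\<close>

lemma linear_bound:
  obtains C where "\<And>t. 0 \<le> t \<Longrightarrow> t \<le> \<Phi> t + C" "0 \<le> C"
proof -
  obtain C where C: "\<And>t. t \<ge> C \<Longrightarrow> 1 \<le> \<Phi> t / t"
    using superlinear unfolding filterlim_at_top eventually_at_top_linorder by blast
  have "t \<le> \<Phi> t + max 1 C" if "0 \<le> t" for t
  proof (cases "t \<ge> max 1 C")
    case True
    then have "t \<le> \<Phi> t" using C[of t] by (simp add: field_simps)
    then show ?thesis by simp
  next
    case False
    then show ?thesis using nonneg[OF that] by linarith
  qed
  then show ?thesis by (intro that[of "max 1 C"]) auto
qed

lemma jensen_average:
  assumes "N > 0" "0 < l"
  shows "\<Phi> (\<bar>(\<Sum>j<N. x j) / real N\<bar> / l) \<le> (\<Sum>j<N. \<Phi> (\<bar>x j\<bar> / l)) / real N"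
proof -
  have "\<bar>(\<Sum>j<N. x j) / real N\<bar> / l \<le> (\<Sum>j<N. (1 / real N) * (\<bar>x j\<bar> / l))"
    using assms by (simp add: sum_divide_distrib[symmetric] divide_right_mono sum_abs field_simps)
  then have "\<Phi> (\<bar>(\<Sum>j<N. x j) / real N\<bar> / l) \<le> \<Phi> (\<Sum>j<N. (1 / real N) * (\<bar>x j\<bar> / l))"
    using assms by (intro mono) auto
  also have "\<dots> \<le> (\<Sum>j<N. (1 / real N) * \<Phi> (\<bar>x j\<bar> / l))"
    using assms convex_on_sum[OF _ _ convex, of "{..<N}" "\<lambda>_. 1 / real N" "\<lambda>j. \<bar>x j\<bar> / l"] by auto
  finally show ?thesis
    by (simp add: sum_divide_distrib)
qed

text \<open>The definition asks for a modular of at most 1; a finite one is enough. Convexity and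
  \<Phi> 0 = 0 give \<Phi>(t / c) \<le> \<Phi>(t) / c for c \<ge> 1, so stretching the scale by c =
  max 1 r brings a modular r down to at most 1.\<close>

lemma LPhiI:
  assumes X: "X \<in> borel_measurable M" and l: "l > 0"
    and fin: "(\<integral>\<^sup>+x. ennreal (\<Phi> (\<bar>X x\<bar> / l)) \<partial>M) < \<infinity>"
  shows "X \<in> LPhi M \<Phi>"
proof -
  note [measurable] = X
  obtain r where r: "(\<integral>\<^sup>+x. ennreal (\<Phi> (\<bar>X x\<bar> / l)) \<partial>M) = ennreal r" "0 \<le> r"
    using fin by (cases "\<integral>\<^sup>+x. ennreal (\<Phi> (\<bar>X x\<bar> / l)) \<partial>M") auto
  define c where "c = max 1 r"
  have c: "c \<ge> 1" "r \<le> c" by (auto simp: c_def)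
  have "(\<integral>\<^sup>+x. ennreal (\<Phi> (\<bar>X x\<bar> / (l * c))) \<partial>M) \<le> (\<integral>\<^sup>+x. ennreal (1 / c) * ennreal (\<Phi> (\<bar>X x\<bar> / l)) \<partial>M)"
  proof (intro nn_integral_mono)
    fix x
    have "\<Phi> (\<bar>X x\<bar> / (l * c)) \<le> 1 / c * \<Phi> (\<bar>X x\<bar> / l)"
      using scale_le[of "1 / c" "\<bar>X x\<bar> / l"] c l by (simp add: mult.commute)
    then show "ennreal (\<Phi> (\<bar>X x\<bar> / (l * c))) \<le> ennreal (1 / c) * ennreal (\<Phi> (\<bar>X x\<bar> / l))"
      using c l nonneg by (simp add: ennreal_mult[symmetric] ennreal_leI)
  qed
  also have "\<dots> = ennreal (1 / c * r)"
    using c r l by (subst nn_integral_cmult) (auto simp: ennreal_mult[symmetric])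
  also have "\<dots> \<le> 1"
    using c r by (simp add: ennreal_le_1)
  finally show ?thesis
    using X l c by (auto simp: LPhi_def intro!: exI[of _ "l * c"])
qed

lemma LPhiE:
  assumes "X \<in> LPhi M \<Phi>"
  obtains l where "l > 0" "(\<integral>\<^sup>+x. ennreal (\<Phi> (\<bar>X x\<bar> / l)) \<partial>M) < \<infinity>"
proof -
  obtain l where l: "l > 0" and "(\<integral>\<^sup>+x. ennreal (\<Phi> (\<bar>X x\<bar> / l)) \<partial>M) \<le> 1"
    using assms by (auto simp: LPhi_def)
  from this(2) have "(\<integral>\<^sup>+x. ennreal (\<Phi> (\<bar>X x\<bar> / l)) \<partial>M) < \<infinity>"
    by (rule le_less_trans) simp
  with l show ?thesis by (rule that)
qed

lemma LPhi_measurable: "X \<in> LPhi M \<Phi> \<Longrightarrow> X \<in> borel_measurable M"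
  by (simp add: LPhi_def)

lemma LPhi_mono:
  assumes Y: "Y \<in> LPhi M \<Phi>" and X: "X \<in> borel_measurable M" and le: "AE x in M. \<bar>X x\<bar> \<le> \<bar>Y x\<bar>"
  shows "X \<in> LPhi M \<Phi>"
proof -
  obtain l where l: "l > 0" "(\<integral>\<^sup>+x. ennreal (\<Phi> (\<bar>Y x\<bar> / l)) \<partial>M) < \<infinity>"
    using Y by (rule LPhiE)
  have "(\<integral>\<^sup>+x. ennreal (\<Phi> (\<bar>X x\<bar> / l)) \<partial>M) \<le> (\<integral>\<^sup>+x. ennreal (\<Phi> (\<bar>Y x\<bar> / l)) \<partial>M)"
    by (intro nn_integral_mono_AE, use le in eventually_elim) (use l in \<open>auto intro!: ennreal_leI mono_abs\<close>)
  with l X show ?thesis by (intro LPhiI[of X M l]) auto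
qed

lemma LPhi_add:
  assumes X: "X \<in> LPhi M \<Phi>" and Y: "Y \<in> LPhi M \<Phi>"
  shows "(\<lambda>x. X x + Y x) \<in> LPhi M \<Phi>"
proof -
  note [measurable] = LPhi_measurable[OF X] LPhi_measurable[OF Y]
  obtain l where l: "l > 0" "(\<integral>\<^sup>+x. ennreal (\<Phi> (\<bar>X x\<bar> / l)) \<partial>M) < \<infinity>"
    using X by (rule LPhiE)
  obtain m where m: "m > 0" "(\<integral>\<^sup>+x. ennreal (\<Phi> (\<bar>Y x\<bar> / m)) \<partial>M) < \<infinity>"
    using Y by (rule LPhiE)
  have "(\<integral>\<^sup>+x. ennreal (\<Phi> (\<bar>X x + Y x\<bar> / (2 * max l m))) \<partial>M)
      \<le> (\<integral>\<^sup>+x. ennreal (\<Phi> (\<bar>X x\<bar> / l)) + ennreal (\<Phi> (\<bar>Y x\<bar> / m)) \<partial>M)"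
  proof (intro nn_integral_mono)
    fix x
    have "\<Phi> (\<bar>X x + Y x\<bar> / (2 * max l m)) \<le> \<Phi> (\<bar>X x\<bar> / max l m) + \<Phi> (\<bar>Y x\<bar> / max l m)"
      using l by (intro abs_add_le) auto
    also have "\<dots> \<le> \<Phi> (\<bar>X x\<bar> / l) + \<Phi> (\<bar>Y x\<bar> / m)"
      using l m by (intro add_mono mono divide_left_mono) auto
    finally have "ennreal (\<Phi> (\<bar>X x + Y x\<bar> / (2 * max l m))) \<le> ennreal (\<Phi> (\<bar>X x\<bar> / l) + \<Phi> (\<bar>Y x\<bar> / m))"
      by (rule ennreal_leI)
    also have "\<dots> = ennreal (\<Phi> (\<bar>X x\<bar> / l)) + ennreal (\<Phi> (\<bar>Y x\<bar> / m))"
      using l m nonneg by (intro ennreal_plus) auto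
    finally show "ennreal (\<Phi> (\<bar>X x + Y x\<bar> / (2 * max l m))) \<le> \<dots>" .
  qed
  also have "\<dots> < \<infinity>"
    using l m by (subst nn_integral_add) auto
  finally show ?thesis
    using l by (intro LPhiI[of _ M "2 * max l m"]) auto
qed

lemma LPhi_scale:
  assumes X: "X \<in> LPhi M \<Phi>"
  shows "(\<lambda>x. c * X x) \<in> LPhi M \<Phi>"
proof -
  note [measurable] = LPhi_measurable[OF X]
  obtain l where l: "l > 0" "(\<integral>\<^sup>+x. ennreal (\<Phi> (\<bar>X x\<bar> / l)) \<partial>M) < \<infinity>"
    using X by (rule LPhiE)
  \<comment> \<open>The stretch |c| + 1 instead of |c| keeps the new scale positive when c =
    0.\<close>
  have "(\<integral>\<^sup>+x. ennreal (\<Phi> (\<bar>c * X x\<bar> / ((\<bar>c\<bar> + 1) * l))) \<partial>M) \<le> (\<integral>\<^sup>+x. ennreal (\<Phi> (\<bar>X x\<bar> / l)) \<partial>M)"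
  proof (intro nn_integral_mono ennreal_leI mono)
    fix x
    have "\<bar>c * X x\<bar> / ((\<bar>c\<bar> + 1) * l) = \<bar>c\<bar> / (\<bar>c\<bar> + 1) * (\<bar>X x\<bar> / l)"
      by (simp add: abs_mult)
    also have "\<dots> \<le> 1 * (\<bar>X x\<bar> / l)"
      using l by (intro mult_right_mono) auto
    finally show "\<bar>c * X x\<bar> / ((\<bar>c\<bar> + 1) * l) \<le> \<bar>X x\<bar> / l" by simp
  qed (use l in auto)
  with l show ?thesis
    by (intro LPhiI[of _ M "(\<bar>c\<bar> + 1) * l"]) auto
qed

lemma LPhi_convex:
  "X \<in> LPhi M \<Phi> \<Longrightarrow> Y \<in> LPhi M \<Phi> \<Longrightarrow> (\<lambda>x. a * X x + b * Y x) \<in> LPhi M \<Phi>"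
  by (intro LPhi_add LPhi_scale)

text \<open>The modular at any scale is an integral against the law of the variable.\<close>

lemma LPhi_distr:
  assumes X: "X \<in> LPhi M \<Phi>" and Y: "Y \<in> borel_measurable M" and eq: "distr M borel X = distr M borel Y"
  shows "Y \<in> LPhi M \<Phi>"
proof -
  have *: "(\<integral>\<^sup>+x. ennreal (\<Phi> (\<bar>Z x\<bar> / l)) \<partial>M) = (\<integral>\<^sup>+z. ennreal (\<Phi> (\<bar>z\<bar> / l)) \<partial>distr M borel Z)"
    if "Z \<in> borel_measurable M" "0 < l" for Z l
    using that by (subst nn_integral_distr) auto
  show ?thesis
    using X Y *[of X] *[of Y] eq by (auto simp: LPhi_def)
qed

end

context prob_space
begin

lemma Linf_subset_LPhi:
  assumes "orlicz \<Phi>" shows "Linf M \<subseteq> LPhi M \<Phi>"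
proof
  interpret orlicz \<Phi> by fact
  fix X assume "X \<in> Linf M"
  then obtain C where X[measurable]: "X \<in> borel_measurable M" and C: "AE x in M. \<bar>X x\<bar> \<le> C"
    by (auto simp: Linf_def)
  have "(\<integral>\<^sup>+x. ennreal (\<Phi> (\<bar>X x\<bar> / 1)) \<partial>M) \<le> (\<integral>\<^sup>+x. ennreal (\<Phi> C) \<partial>M)"
    by (intro nn_integral_mono_AE, use C in eventually_elim) (auto intro!: ennreal_leI mono)
  also have "\<dots> < \<infinity>" by (simp add: emeasure_space_1)
  finally show "X \<in> LPhi M \<Phi>" by (intro LPhiI[of X M 1]) auto
qed

lemma LPhi_integrable:
  assumes "orlicz \<Phi>" and X: "X \<in> LPhi M \<Phi>" shows "integrable M X"
proof -
  interpret orlicz \<Phi> by fact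
  note [measurable] = LPhi_measurable[OF X]
  obtain l where l: "l > 0" "(\<integral>\<^sup>+x. ennreal (\<Phi> (\<bar>X x\<bar> / l)) \<partial>M) < \<infinity>"
    using X by (rule LPhiE)
  obtain C where C: "\<And>t. 0 \<le> t \<Longrightarrow> t \<le> \<Phi> t + C" "0 \<le> C" by (rule linear_bound) blast
  have "(\<integral>\<^sup>+x. ennreal (\<bar>X x\<bar> / l) \<partial>M) \<le> (\<integral>\<^sup>+x. ennreal (\<Phi> (\<bar>X x\<bar> / l)) + ennreal C \<partial>M)"
    using C l nonneg by (intro nn_integral_mono) (auto simp: ennreal_plus[symmetric] simp del: ennreal_plus intro!: ennreal_leI)
  also have "\<dots> < \<infinity>"
    using l by (subst nn_integral_add) (auto simp: emeasure_space_1)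
  finally have "integrable M (\<lambda>x. X x / l)"
    using l by (intro integrableI_bounded) auto
  then have "integrable M (\<lambda>x. l * (X x / l))" by (rule integrable_mult_right)
  with l show ?thesis by simp
qed

end

section \<open>Riemann sums along rotations\<close>

context orlicz
begin

text \<open>The bridge from modular convergence to the hypotheses of the Fatou property. Along a
  subsequence with modulars below 2^-k the sum G of the integrands is integrable, hence finite a.e.;
  this forces the terms to 0, and G also dominates the modular integrand of the supremum of the
  sequence.\<close>

lemma modular_subsequence:
  fixes Z :: "nat \<Rightarrow> 'a \<Rightarrow> real"
  assumes Z[measurable]: "\<And>n. Z n \<in> borel_measurable M" and l: "0 < l"
    and lim: "(\<lambda>n. \<integral>\<^sup>+x. ennreal (\<Phi> (\<bar>Z n x\<bar> / l)) \<partial>M) \<longlonglongrightarrow> 0"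
  obtains r :: "nat \<Rightarrow> nat" and D where "strict_mono r" "D \<in> LPhi M \<Phi>"
    "AE x in M. (\<lambda>k. Z (r k) x) \<longlonglongrightarrow> 0" "\<And>k. AE x in M. \<bar>Z (r k) x\<bar> \<le> D x"
proof -
  have meas[measurable]: "(\<lambda>x. \<Phi> (\<bar>Z n x\<bar> / l)) \<in> borel_measurable M" for n
    by (rule measurable_Phi[OF Z l])
  define I where "I n = (\<integral>\<^sup>+x. ennreal (\<Phi> (\<bar>Z n x\<bar> / l)) \<partial>M)" for n
  have "\<exists>r :: nat \<Rightarrow> nat. \<forall>k. I (r k) < ennreal ((1 / 2) ^ k) \<and> r k < r (Suc k)"
  proof (rule dependent_nat_choice)
    have ev: "\<forall>\<^sub>F n in sequentially. I n < ennreal ((1 / 2) ^ k)" for k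
      using lim unfolding I_def[symmetric] by (rule order_tendstoD) simp
    show "\<exists>n. I n < ennreal ((1 / 2) ^ 0)"
      using eventually_happens[OF ev[of 0]] by auto
    show "\<exists>m. I m < ennreal ((1 / 2) ^ Suc k) \<and> n < m" for n k
      using eventually_happens[OF eventually_conj[OF ev[of "Suc k"] eventually_gt_at_top[of n]]] by auto
  qed
  then obtain r :: "nat \<Rightarrow> nat" where r: "\<And>k. I (r k) < ennreal ((1 / 2) ^ k)" "strict_mono r"
    by (auto simp: strict_mono_Suc_iff)
  define G where "G x = (\<Sum>k. ennreal (\<Phi> (\<bar>Z (r k) x\<bar> / l)))" for x
  have G[measurable]: "G \<in> borel_measurable M"
    unfolding G_def by measurable
  have "(\<integral>\<^sup>+x. G x \<partial>M) = (\<Sum>k. I (r k))"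
    unfolding G_def I_def by (intro nn_integral_suminf) measurable
  also have "\<dots> \<le> (\<Sum>k. ennreal ((1 / 2) ^ k))"
    by (intro suminf_le less_imp_le r) auto
  also have "\<dots> = ennreal (\<Sum>k. (1 / 2) ^ k)"
    by (intro suminf_ennreal2) (auto intro: summable_geometric)
  finally have Gfin: "(\<integral>\<^sup>+x. G x \<partial>M) < \<infinity>"
    by (auto intro: le_less_trans)
  then have AEG: "AE x in M. G x \<noteq> \<infinity>"
    by (intro nn_integral_PInf_AE) auto
  have conv: "(\<lambda>k. Z (r k) x) \<longlonglongrightarrow> 0" if "G x \<noteq> \<infinity>" for x
  proof -
    have "summable (\<lambda>k. \<Phi> (\<bar>Z (r k) x\<bar> / l))"
      using that l nonneg by (intro summable_suminf_not_top) (auto simp: G_def)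
    then have to0: "(\<lambda>k. \<Phi> (\<bar>Z (r k) x\<bar> / l)) \<longlonglongrightarrow> 0"
      by (rule summable_LIMSEQ_zero)
    show ?thesis
    proof (rule LIMSEQ_I)
      fix e :: real assume e: "0 < e"
      \<comment> \<open>Positivity of \<Phi> away from 0 is what turns \<Phi>(|Z| / l) tending to 0
        into Z tending to 0.\<close>
      with l have "\<forall>\<^sub>F k in sequentially. \<Phi> (\<bar>Z (r k) x\<bar> / l) < \<Phi> (e / l)"
        by (intro order_tendstoD(2)[OF to0] pos) auto
      then have "\<forall>\<^sub>F k in sequentially. norm (Z (r k) x - 0) < e"
      proof eventually_elim
        case (elim k)
        then show ?case
          using mono[of "e / l" "\<bar>Z (r k) x\<bar> / l"] e l
          by (cases "e \<le> \<bar>Z (r k) x\<bar>") (auto simp: divide_right_mono)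
      qed
      then show "\<exists>no. \<forall>n\<ge>no. norm (Z (r n) x - 0) < e"
        by (simp add: eventually_sequentially)
    qed
  qed
  \<comment> \<open>The supremum is taken in the extended nonnegative reals, where it is always
    defined and measurable; wherever G is finite it is finite too, and \<open>enn2real\<close> loses
    nothing.\<close>
  define D where "D x = enn2real (SUP k. ennreal \<bar>Z (r k) x\<bar>)" for x
  have D[measurable]: "D \<in> borel_measurable M"
    unfolding D_def by measurable
  have Sup_fin: "(SUP k. ennreal \<bar>Z (r k) x\<bar>) < \<infinity>" if "G x \<noteq> \<infinity>" for x
  proof -
    have "Bseq (\<lambda>k. Z (r k) x)"
      using conv[OF that] by (intro convergent_imp_Bseq) (auto simp: convergent_def)
    then obtain K where "\<And>k. \<bar>Z (r k) x\<bar> \<le> K"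
      by (auto simp: Bseq_def)
    then have "(SUP k. ennreal \<bar>Z (r k) x\<bar>) \<le> ennreal K"
      by (intro SUP_least ennreal_leI)
    then show ?thesis by (auto intro: le_less_trans)
  qed
  then have D_eq: "ennreal (D x) = (SUP k. ennreal \<bar>Z (r k) x\<bar>)" if "G x \<noteq> \<infinity>" for x
    using that unfolding D_def by simp
  have le_D: "\<bar>Z (r k) x\<bar> \<le> D x" if "G x \<noteq> \<infinity>" for x k
  proof -
    have "ennreal \<bar>Z (r k) x\<bar> \<le> ennreal (D x)"
      unfolding D_eq[OF that] by (intro SUP_upper) auto
    then show ?thesis by (simp add: D_def)
  qed
  have PhiD: "ennreal (\<Phi> (\<bar>D x\<bar> / (2 * l))) \<le> G x" if "G x \<noteq> \<infinity>" for x
  proof (cases "D x = 0")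
    case False
    then have "D x > 0" by (simp add: D_def order_less_le)
    \<comment> \<open>The supremum need not be attained, but some term exceeds half of it; hence the
      scale \<open>2 * l\<close> for \<open>D\<close>.\<close>
    then have "ennreal (D x / 2) < (SUP k. ennreal \<bar>Z (r k) x\<bar>)"
      unfolding D_eq[OF that, symmetric] by (intro ennreal_lessI) auto
    then obtain k where "ennreal (D x / 2) < ennreal \<bar>Z (r k) x\<bar>"
      by (auto simp: less_SUP_iff)
    then have "D x / 2 \<le> \<bar>Z (r k) x\<bar>"
      by (simp add: ennreal_less_iff[OF order_less_imp_le] \<open>D x > 0\<close>)
    then have "\<bar>D x\<bar> / (2 * l) \<le> \<bar>Z (r k) x\<bar> / l"
      using l \<open>D x > 0\<close> by (simp add: field_simps)
    then have "ennreal (\<Phi> (\<bar>D x\<bar> / (2 * l))) \<le> ennreal (\<Phi> (\<bar>Z (r k) x\<bar> / l))"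
      using l by (intro ennreal_leI mono) auto
    also have "\<dots> \<le> G x"
      unfolding G_def using sum_le_suminf[of "\<lambda>k. ennreal (\<Phi> (\<bar>Z (r k) x\<bar> / l))" "{k}"] by auto
    finally show ?thesis .
  qed simp
  have "(\<integral>\<^sup>+x. ennreal (\<Phi> (\<bar>D x\<bar> / (2 * l))) \<partial>M) \<le> (\<integral>\<^sup>+x. G x \<partial>M)"
    by (intro nn_integral_mono_AE, use AEG in eventually_elim) (rule PhiD)
  then have "D \<in> LPhi M \<Phi>"
    using Gfin l by (intro LPhiI[of D M "2 * l"]) auto
  moreover have "AE x in M. (\<lambda>k. Z (r k) x) \<longlonglongrightarrow> 0"
    using AEG by eventually_elim (rule conv)
  moreover have "AE x in M. \<bar>Z (r k) x\<bar> \<le> D x" for k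
    using AEG by eventually_elim (rule le_D)
  ultimately show ?thesis
    using that r(2) by blast
qed

text \<open>All rotations have the same integral, so the mean of the sampled sum is N times the
  integral of g. A function whose oscillation is at most 2 * K stays within 2 * K of its mean, and
  division by N gives the rate. The value - K at and left of 0 keeps g monotone on the half-open
  interval, since the fractional part may hit 0.\<close>

lemma clamp_rotation_average:
  fixes q :: "real \<Rightarrow> real" and K :: real
  assumes q: "mono_on {0<..<1} q" and [measurable]: "q \<in> borel_measurable borel" and K: "0 \<le> K"
    and N: "N > 0"
  defines "g \<equiv> \<lambda>u. if u \<le> 0 then - K else max (- K) (min K (q u))"
  shows "AE u in unif. \<bar>(\<Sum>j<N. g (frac (u + real j / real N))) / real N - (\<integral>u. g u \<partial>unif)\<bar> \<le> 2 * K / real N"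
proof -
  interpret U: prob_space unif by (rule prob_space_unif)
  have g[measurable]: "g \<in> borel_measurable borel"
    unfolding g_def by measurable
  have gK: "\<bar>g u\<bar> \<le> K" for u using K by (auto simp: g_def)
  have gmono: "mono_on {0..<1} g"
  proof (rule mono_onI)
    fix r s :: real assume rs: "r \<in> {0..<1}" "s \<in> {0..<1}" "r \<le> s"
    show "g r \<le> g s"
    proof (cases "r = 0")
      case False
      with rs have "q r \<le> q s" by (intro mono_onD[OF q]) auto
      with rs False K show ?thesis by (auto simp: g_def max_def min_def)
    qed (use K in \<open>auto simp: g_def\<close>)
  qed
  let ?S = "\<lambda>u. \<Sum>j<N. g (frac (u + real j / real N))"
  have [measurable]: "(\<lambda>u::real. frac u) \<in> borel_measurable borel"
    by (simp add: frac_def)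
  have int_g: "integrable unif g"
    using gK by (intro U.integrable_const_bound[of _ K]) auto
  have int_rot: "integrable unif (\<lambda>u. g (frac (u + real j / real N)))"
    and eq_rot: "(\<integral>u. g (frac (u + real j / real N)) \<partial>unif) = (\<integral>u. g u \<partial>unif)" if "j < N" for j
  proof -
    have *: "distr unif borel (\<lambda>u. frac (u + real j / real N)) = unif"
      using that by (intro distr_unif_rotate) auto
    have "integrable (distr unif borel (\<lambda>u. frac (u + real j / real N))) g"
      unfolding * by (rule int_g)
    then show "integrable unif (\<lambda>u. g (frac (u + real j / real N)))"
      by (subst (asm) integrable_distr_eq) auto
    have "(\<integral>u. g u \<partial>distr unif borel (\<lambda>u. frac (u + real j / real N))) = (\<integral>u. g u \<partial>unif)"
      unfolding * ..
    then show "(\<integral>u. g (frac (u + real j / real N)) \<partial>unif) = (\<integral>u. g u \<partial>unif)"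
      by (subst (asm) integral_distr) auto
  qed
  have int_S: "integrable unif ?S"
    by (intro Bochner_Integration.integrable_sum int_rot) auto
  have mean: "(\<integral>u. ?S u \<partial>unif) = real N * (\<integral>u. g u \<partial>unif)"
    by (subst Bochner_Integration.integral_sum) (auto simp: int_rot eq_rot)
  \<comment> \<open>The oscillation bound for fixed u is integrated over v.\<close>
  have dev: "\<bar>?S u - real N * (\<integral>u. g u \<partial>unif)\<bar> \<le> 2 * K" if u: "0 < u" "u < 1" for u
  proof -
    have osc: "AE v in unif. ?S u \<le> ?S v + 2 * K" "AE v in unif. ?S v \<le> ?S u + 2 * K"
      using AE_unif by (eventually_elim, intro rotation_average_oscillation gmono gK N, use u in auto)+
    have "(\<integral>v. ?S u \<partial>unif) \<le> (\<integral>v. ?S v + 2 * K \<partial>unif)"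
      using osc(1) int_S by (intro integral_mono_AE) auto
    moreover have "(\<integral>v. ?S v \<partial>unif) \<le> (\<integral>v. ?S u + 2 * K \<partial>unif)"
      using osc(2) int_S by (intro integral_mono_AE) auto
    ultimately show ?thesis
      using int_S by (simp add: U.prob_space mean abs_le_iff)
  qed
  show ?thesis
    using AE_unif
  proof eventually_elim
    case (elim u)
    then have "\<bar>?S u - real N * (\<integral>u. g u \<partial>unif)\<bar> / real N \<le> 2 * K / real N"
      by (intro divide_right_mono dev) auto
    moreover have "?S u / real N - (\<integral>u. g u \<partial>unif) = (?S u - real N * (\<integral>u. g u \<partial>unif)) / real N"
      using N by (simp add: field_simps)
    ultimately show ?case
      by (simp add: abs_divide)
  qed
qed

text \<open>Clamping splits q into a bounded part g and a remainder h. The Riemann sums of g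
  approach their mean uniformly. For h, Jensen's inequality moves \<Phi> inside the sum and rotation
  invariance reduces every term to one tail modular of q. The two parts are combined at the doubled
  scale.\<close>

lemma rotation_averages_modular_tendsto:
  fixes q :: "real \<Rightarrow> real"
  assumes q: "mono_on {0<..<1} q" and q_meas[measurable]: "q \<in> borel_measurable borel" and l: "0 < l"
    and fin: "(\<integral>\<^sup>+u. ennreal (\<Phi> (\<bar>q u\<bar> / l)) \<partial>unif) < \<infinity>"
  shows "(\<lambda>N. \<integral>\<^sup>+u. ennreal (\<Phi> (\<bar>(\<Sum>j<N. q (frac (u + real j / real N))) / real N - (\<integral>u. q u \<partial>unif)\<bar> / (2 * l))) \<partial>unif)
    \<longlonglongrightarrow> 0"
proof -
  interpret U: prob_space unif by (rule prob_space_unif)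
  have [measurable]: "(\<lambda>u::real. frac u) \<in> borel_measurable borel"
    by (simp add: frac_def)
  have qL: "q \<in> LPhi unif \<Phi>"
    using l fin by (intro LPhiI[of q _ l]) auto
  then have int_q: "integrable unif q"
    by (rule U.LPhi_integrable[OF orlicz_axioms])
  \<comment> \<open>The clamp level must tend to infinity, so that the tails vanish, yet slower than
    N, so that the error 2 * K / N vanishes; the square root does both.\<close>
  define K where "K N = sqrt (real N)" for N
  define g where "g N = (\<lambda>u. if u \<le> 0 then - K N else max (- K N) (min (K N) (q u)))" for N
  define h where "h N u = q u - g N u" for N u
  have K0: "0 \<le> K N" for N by (simp add: K_def)
  have K_top: "filterlim K at_top sequentially"
    unfolding K_def by (intro filterlim_compose[OF sqrt_at_top] filterlim_real_sequentially)
  have g_meas[measurable]: "g N \<in> borel_measurable borel" for N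
    unfolding g_def by measurable
  have h_meas[measurable]: "h N \<in> borel_measurable borel" for N
    unfolding h_def by measurable
  have h_le: "AE u in unif. \<bar>h N u\<bar> \<le> \<bar>q u\<bar> * indicator {u. K N < \<bar>q u\<bar>} u" for N
    using AE_unif by eventually_elim (use K0[of N] in \<open>auto simp: h_def g_def indicator_def split: split_max split_min\<close>)
  have int_g: "integrable unif (g N)" for N
    using K0[of N] by (intro U.integrable_const_bound[of _ "K N"]) (auto simp: g_def)
  have int_h: "integrable unif (h N)" for N
    unfolding h_def using int_q int_g by auto
  have h_tail: "ennreal (\<Phi> (\<bar>h N u\<bar> / l)) \<le> ennreal (\<Phi> (\<bar>q u\<bar> / l)) * indicator {u. K N < \<bar>q u\<bar>} u"
    if "\<bar>h N u\<bar> \<le> \<bar>q u\<bar> * indicator {u. K N < \<bar>q u\<bar>} u" for N u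
    using that l by (auto simp: indicator_def split: if_splits intro!: ennreal_leI mono_abs)
  define T where "T N = (\<integral>\<^sup>+u. ennreal (\<Phi> (\<bar>q u\<bar> / l)) * indicator {u. K N < \<bar>q u\<bar>} u \<partial>unif)" for N
  have T: "T \<longlonglongrightarrow> 0"
    unfolding T_def using l fin by (intro tendsto_nn_integral_tail K_top) auto
  define t where "t N = (\<integral>\<^sup>+u. ennreal \<bar>q u\<bar> * indicator {u. K N < \<bar>q u\<bar>} u \<partial>unif)" for N
  have fin_q: "(\<integral>\<^sup>+u. ennreal \<bar>q u\<bar> \<partial>unif) < \<infinity>"
    using int_q by (simp add: integrable_iff_bounded)
  have t0: "t \<longlonglongrightarrow> 0"
    unfolding t_def using fin_q by (intro tendsto_nn_integral_tail K_top) auto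
  have t_fin: "t N < \<infinity>" for N
    unfolding t_def by (rule le_less_trans[OF nn_integral_mono fin_q]) (auto simp: indicator_def)
  \<comment> \<open>The deterministic error: sampling error of the clamped part plus the bound on
    the mean of the remainder.\<close>
  define a where "a N = 2 * K N / real N + enn2real (t N)" for N
  have a0: "0 \<le> a N" for N using K0 by (simp add: a_def)
  have "(\<lambda>N. enn2real (t N)) \<longlonglongrightarrow> 0"
    using tendsto_enn2real[of t 0 sequentially] t0 by simp
  moreover have "(\<lambda>N. 2 * K N / real N) \<longlonglongrightarrow> 0"
    unfolding K_def by real_asymp
  ultimately have a_lim: "a \<longlonglongrightarrow> 0"
    unfolding a_def using tendsto_add by fastforce
  have mean_h: "\<bar>\<integral>u. h N u \<partial>unif\<bar> \<le> enn2real (t N)" for N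
  proof -
    have "ennreal \<bar>\<integral>u. h N u \<partial>unif\<bar> \<le> (\<integral>\<^sup>+u. ennreal \<bar>h N u\<bar> \<partial>unif)"
      using integral_norm_bound_ennreal[OF int_h] by simp
    also have "\<dots> \<le> t N"
      unfolding t_def by (intro nn_integral_mono_AE, use h_le[of N] in eventually_elim)
        (auto simp: indicator_def split: if_splits intro!: ennreal_leI)
    finally show ?thesis
      using t_fin by (metis enn2real_ennreal enn2real_mono abs_ge_zero infinity_ennreal_def)
  qed
  let ?S = "\<lambda>f N u. (\<Sum>j<N. f (frac (u + real j / real N))) / real N"
  have "(\<integral>\<^sup>+u. ennreal (\<Phi> (\<bar>?S q N u - (\<integral>u. q u \<partial>unif)\<bar> / (2 * l))) \<partial>unif) \<le> ennreal (\<Phi> (a N / l)) + T N"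
    if N: "N > 0" for N
  proof -
    have "(\<integral>\<^sup>+u. ennreal (\<Phi> (\<bar>?S q N u - (\<integral>u. q u \<partial>unif)\<bar> / (2 * l))) \<partial>unif)
        \<le> (\<integral>\<^sup>+u. ennreal (\<Phi> (a N / l)) + ennreal (1 / real N) * (\<Sum>j<N. ennreal (\<Phi> (\<bar>h N (frac (u + real j / real N))\<bar> / l))) \<partial>unif)"
    proof (rule nn_integral_mono_AE, use clamp_rotation_average[OF q q_meas K0 N] in eventually_elim)
      fix u
      assume "\<bar>(\<Sum>j<N. if frac (u + real j / real N) \<le> 0 then - K N
                else max (- K N) (min (K N) (q (frac (u + real j / real N))))) / real N
          - (\<integral>u. (if u \<le> 0 then - K N else max (- K N) (min (K N) (q u))) \<partial>unif)\<bar> \<le> 2 * K N / real N"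
      then have gS: "\<bar>?S (g N) N u - (\<integral>u. g N u \<partial>unif)\<bar> \<le> 2 * K N / real N"
        by (simp only: g_def)
      have "?S q N u = ?S (g N) N u + ?S (h N) N u"
        by (simp add: h_def sum_subtractf diff_divide_distrib)
      moreover have "(\<integral>u. q u \<partial>unif) = (\<integral>u. g N u \<partial>unif) + (\<integral>u. h N u \<partial>unif)"
        using int_q int_g by (simp add: h_def)
      ultimately have eq: "?S q N u - (\<integral>u. q u \<partial>unif)
          = (?S (g N) N u - (\<integral>u. g N u \<partial>unif) - (\<integral>u. h N u \<partial>unif)) + ?S (h N) N u" (is "_ = ?d + _")
        by simp
      have d: "\<bar>?d\<bar> \<le> \<bar>a N\<bar>"
        using gS mean_h[of N] a0[of N] unfolding a_def by linarith
      have "\<Phi> (\<bar>?S q N u - (\<integral>u. q u \<partial>unif)\<bar> / (2 * l)) \<le> \<Phi> (\<bar>?d\<bar> / l) + \<Phi> (\<bar>?S (h N) N u\<bar> / l)"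
        unfolding eq by (rule abs_add_le[OF l])
      also have "\<dots> \<le> \<Phi> (a N / l) + (\<Sum>j<N. \<Phi> (\<bar>h N (frac (u + real j / real N))\<bar> / l)) / real N"
        using mono_abs[OF d l] a0[of N] by (intro add_mono jensen_average N l) auto
      finally have "ennreal (\<Phi> (\<bar>?S q N u - (\<integral>u. q u \<partial>unif)\<bar> / (2 * l)))
          \<le> ennreal (\<Phi> (a N / l) + 1 / real N * (\<Sum>j<N. \<Phi> (\<bar>h N (frac (u + real j / real N))\<bar> / l)))"
        by (intro ennreal_leI) simp
      also have "\<dots> = ennreal (\<Phi> (a N / l)) + ennreal (1 / real N * (\<Sum>j<N. \<Phi> (\<bar>h N (frac (u + real j / real N))\<bar> / l)))"
        using a0 l by (intro ennreal_plus mult_nonneg_nonneg sum_nonneg nonneg) auto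
      also have "ennreal (1 / real N * (\<Sum>j<N. \<Phi> (\<bar>h N (frac (u + real j / real N))\<bar> / l)))
          = ennreal (1 / real N) * (\<Sum>j<N. ennreal (\<Phi> (\<bar>h N (frac (u + real j / real N))\<bar> / l)))"
      proof -
        have nn: "0 \<le> \<Phi> (\<bar>h N (frac (u + real j / real N))\<bar> / l)" for j
          using l by (intro nonneg) auto
        show ?thesis
          unfolding sum_ennreal[OF nn] by (rule ennreal_mult) (simp_all add: sum_nonneg nn)
      qed
      finally show "ennreal (\<Phi> (\<bar>?S q N u - (\<integral>u. q u \<partial>unif)\<bar> / (2 * l)))
          \<le> ennreal (\<Phi> (a N / l)) + ennreal (1 / real N) * (\<Sum>j<N. ennreal (\<Phi> (\<bar>h N (frac (u + real j / real N))\<bar> / l)))" .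
    qed
    also have "\<dots> = ennreal (\<Phi> (a N / l)) + ennreal (1 / real N) *
        (\<Sum>j<N. \<integral>\<^sup>+u. ennreal (\<Phi> (\<bar>h N (frac (u + real j / real N))\<bar> / l)) \<partial>unif)"
      using l by (subst nn_integral_add) (auto simp: nn_integral_cmult nn_integral_sum U.emeasure_space_1[simplified])
    also have "(\<Sum>j<N. \<integral>\<^sup>+u. ennreal (\<Phi> (\<bar>h N (frac (u + real j / real N))\<bar> / l)) \<partial>unif) \<le> (\<Sum>j<N. T N)"
    proof (rule sum_mono)
      fix j assume "j \<in> {..<N}"
      then have *: "distr unif borel (\<lambda>u. frac (u + real j / real N)) = unif"
        by (intro distr_unif_rotate) auto
      have "(\<integral>\<^sup>+u. ennreal (\<Phi> (\<bar>h N (frac (u + real j / real N))\<bar> / l)) \<partial>unif)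
          = (\<integral>\<^sup>+u. ennreal (\<Phi> (\<bar>h N u\<bar> / l)) \<partial>distr unif borel (\<lambda>u. frac (u + real j / real N)))"
        using l by (subst nn_integral_distr) auto
      also have "\<dots> = (\<integral>\<^sup>+u. ennreal (\<Phi> (\<bar>h N u\<bar> / l)) \<partial>unif)"
        unfolding * ..
      also have "\<dots> \<le> T N"
        unfolding T_def by (intro nn_integral_mono_AE, use h_le[of N] in eventually_elim) (rule h_tail)
      finally show "(\<integral>\<^sup>+u. ennreal (\<Phi> (\<bar>h N (frac (u + real j / real N))\<bar> / l)) \<partial>unif) \<le> T N" .
    qed
    also have "ennreal (1 / real N) * (\<Sum>j<N. T N) = T N"
      using N by (simp add: mult.assoc[symmetric] ennreal_of_nat_eq_real_of_nat ennreal_mult[symmetric])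
    finally show ?thesis
      by (simp add: add_left_mono mult_left_mono)
  qed
  note bound = this
  have "(\<lambda>N. ennreal (\<Phi> (a N / l)) + T N) \<longlonglongrightarrow> ennreal 0 + 0"
    using l a0 tendsto_divide[OF a_lim tendsto_const, of l]
    by (intro tendsto_add T tendsto_ennrealI tendsto_at_zero) auto
  then have lim: "(\<lambda>N. ennreal (\<Phi> (a N / l)) + T N) \<longlonglongrightarrow> 0" by simp
  show ?thesis
    by (rule tendsto_sandwich[OF _ _ tendsto_const lim])
      (auto intro!: eventually_mono[OF eventually_gt_at_top[of 0]] bound)
qed

end

section \<open>Averages over an event\<close>

text \<open>For A of positive probability and integrable X this is the conditional expectation of X
  when A is made an atom and everything outside A stays visible. On a null A the quotient is 0 by
  division by zero, which alters X on a null set only.\<close>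

definition avg :: "'a measure \<Rightarrow> 'a set \<Rightarrow> ('a \<Rightarrow> real) \<Rightarrow> 'a \<Rightarrow> real" where
  "avg M A X \<omega> = (if \<omega> \<in> A then (\<integral>x. indicator A x * X x \<partial>M) / measure M A else X \<omega>)"

text \<open>The strict inequality makes X nonzero on every tail, n = 0 included, as
  \<open>jensen_integral\<close> demands, and leaves |X| \<le> n outside.\<close>

definition tail :: "'a measure \<Rightarrow> nat \<Rightarrow> ('a \<Rightarrow> real) \<Rightarrow> 'a set" where
  "tail M n X = {\<omega> \<in> space M. real n < \<bar>X \<omega>\<bar>}"

definition tail_avg :: "'a measure \<Rightarrow> nat \<Rightarrow> ('a \<Rightarrow> real) \<Rightarrow> 'a \<Rightarrow> real" where
  "tail_avg M n X = avg M (tail M n X) X"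

lemma tail_sets[measurable]: "X \<in> borel_measurable M \<Longrightarrow> tail M n X \<in> sets M"
  unfolding tail_def by measurable

lemma avg_measurable[measurable]:
  assumes [measurable]: "A \<in> sets M" "X \<in> borel_measurable M"
  shows "avg M A X \<in> borel_measurable M"
  unfolding avg_def by measurable

lemma tail_avg_measurable[measurable]:
  "X \<in> borel_measurable M \<Longrightarrow> tail_avg M n X \<in> borel_measurable M"
  unfolding tail_avg_def by measurable

text \<open>Jensen's inequality is applied to |X| / l on the open half-line \<open>{0<..}\<close>;
  this is why X must be nonzero a.e.\<close>

lemma (in orlicz) jensen_integral:
  assumes N: "prob_space N" and X[measurable]: "X \<in> borel_measurable N" and l: "0 < l"
    and fin: "(\<integral>\<^sup>+x. ennreal (\<Phi> (\<bar>X x\<bar> / l)) \<partial>N) < \<infinity>"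
    and pos: "AE x in N. X x \<noteq> 0"
  shows "ennreal (\<Phi> (\<bar>\<integral>x. X x \<partial>N\<bar> / l)) \<le> (\<integral>\<^sup>+x. ennreal (\<Phi> (\<bar>X x\<bar> / l)) \<partial>N)"
proof -
  interpret N: prob_space N by fact
  have "X \<in> LPhi N \<Phi>" using l fin by (intro LPhiI[of X N l]) auto
  then have int: "integrable N X" by (rule N.LPhi_integrable[OF orlicz_axioms])
  have meas: "(\<lambda>x. \<Phi> (\<bar>X x\<bar> / l)) \<in> borel_measurable N" using l by measurable
  have nn: "0 \<le> \<Phi> (\<bar>X x\<bar> / l)" for x using l by (intro nonneg) auto
  have int2: "integrable N (\<lambda>x. \<Phi> (\<bar>X x\<bar> / l))"
    using fin meas nn by (intro integrableI_nonneg) auto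
  have conv: "convex_on {0<..} \<Phi>"
    by (rule convex_on_subset[OF convex]) auto
  have "\<bar>\<integral>x. X x \<partial>N\<bar> / l \<le> (\<integral>x. \<bar>X x\<bar> / l \<partial>N)"
    using l by (simp add: divide_right_mono integral_abs_bound)
  then have "\<Phi> (\<bar>\<integral>x. X x \<partial>N\<bar> / l) \<le> \<Phi> (\<integral>x. \<bar>X x\<bar> / l \<partial>N)"
    using l by (intro mono) auto
  also have "\<dots> \<le> (\<integral>x. \<Phi> (\<bar>X x\<bar> / l) \<partial>N)"
    using int int2 conv l pos
    by (intro N.jensens_inequality[where I = "{0<..}" and a = 0]) (auto elim!: eventually_mono)
  finally have "ennreal (\<Phi> (\<bar>\<integral>x. X x \<partial>N\<bar> / l)) \<le> ennreal (\<integral>x. \<Phi> (\<bar>X x\<bar> / l) \<partial>N)"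
    by (rule ennreal_leI)
  also have "\<dots> = (\<integral>\<^sup>+x. ennreal (\<Phi> (\<bar>X x\<bar> / l)) \<partial>N)"
    using int2 nn by (simp add: nn_integral_eq_integral)
  finally show ?thesis .
qed

context prob_space
begin

lemma integral_uniform_measure:
  fixes X :: "'a \<Rightarrow> real"
  assumes A: "A \<in> events" "prob A > 0" and X: "X \<in> borel_measurable M"
  shows "(\<integral>x. X x \<partial>uniform_measure M A) = (\<integral>x. indicator A x * X x \<partial>M) / prob A"
proof -
  have "uniform_measure M A = density M (\<lambda>x. ennreal (indicator A x / prob A))"
    unfolding uniform_measure_def using A
    by (intro arg_cong[where f = "density M"])
      (auto simp: fun_eq_iff emeasure_eq_measure divide_ennreal indicator_def simp flip: ennreal_1)
  then have "(\<integral>x. X x \<partial>uniform_measure M A) = (\<integral>x. (indicator A x / prob A) * X x \<partial>M)"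
    using A X by (simp add: integral_density)
  also have "\<dots> = (\<integral>x. (indicator A x * X x) / prob A \<partial>M)"
    by (intro Bochner_Integration.integral_cong) auto
  also have "\<dots> = (\<integral>x. indicator A x * X x \<partial>M) / prob A"
    by (rule integral_divide_zero)
  finally show ?thesis .
qed

text \<open>Lets the uniform variable be constructed under the conditional measure on an event,
  where the rearrangement takes place.\<close>

lemma nonatomic_uniform_measure:
  assumes na: "nonatomic M" and A: "A \<in> events" "prob A > 0"
  shows "nonatomic (uniform_measure M A)"
  unfolding nonatomic_def
proof (intro ballI impI)
  have [simp]: "emeasure M A \<noteq> 0" using A by (simp add: emeasure_eq_measure)
  have m: "measure (uniform_measure M A) B = prob (A \<inter> B) / prob A" if "B \<in> events" for B
    using that A by (intro measure_uniform_measure) (auto simp: emeasure_eq_measure)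
  fix B assume B: "B \<in> sets (uniform_measure M A)" "0 < measure (uniform_measure M A) B"
  then have "A \<inter> B \<in> events" "prob (A \<inter> B) > 0"
    using A by (auto simp: m zero_less_divide_iff)
  then obtain C where C: "C \<in> events" "C \<subseteq> A \<inter> B" "0 < prob C" "prob C < prob (A \<inter> B)"
    using na unfolding nonatomic_def by blast
  then have "A \<inter> C = C" by auto
  with B C A show "\<exists>C\<in>sets (uniform_measure M A). C \<subseteq> B \<and> 0 < measure (uniform_measure M A) C \<and>
      measure (uniform_measure M A) C < measure (uniform_measure M A) B"
    by (intro bexI[of _ C]) (auto simp: m divide_strict_right_mono)
qed

text \<open>A law is the sum of its contributions from A and from the complement. The second is
  unchanged, and the first depends only on the conditional law given A.\<close>

lemma distr_glue:
  assumes A[measurable]: "A \<in> events" and pA: "prob A > 0"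
    and [measurable]: "V \<in> borel_measurable M" "X \<in> borel_measurable M"
    and eq: "distr (uniform_measure M A) borel V = distr (uniform_measure M A) borel X"
  shows "distr M borel (\<lambda>\<omega>. if \<omega> \<in> A then V \<omega> else X \<omega>) = distr M borel (X :: 'a \<Rightarrow> real)"
proof (rule measure_eqI)
  fix B assume "B \<in> sets (distr M borel (\<lambda>\<omega>. if \<omega> \<in> A then V \<omega> else X \<omega>))"
  then have B[measurable]: "B \<in> sets borel" by simp
  have on: "emeasure M (A \<inter> (V -` B \<inter> space M)) = emeasure M (A \<inter> (X -` B \<inter> space M))"
  proof -
    have "emeasure (distr (uniform_measure M A) borel V) B = emeasure (distr (uniform_measure M A) borel X) B"
      by (simp add: eq)
    then have "emeasure M (A \<inter> (V -` B \<inter> space M)) / emeasure M A = emeasure M (A \<inter> (X -` B \<inter> space M)) / emeasure M A"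
      by (subst (asm) (1 2) emeasure_distr) (auto simp: measurable_sets)
    then show ?thesis
      using pA by (auto simp: emeasure_eq_measure divide_ennreal)
  qed
  have split: "emeasure M (Z -` B \<inter> space M)
      = emeasure M (A \<inter> (Z -` B \<inter> space M)) + emeasure M ((space M - A) \<inter> (Z -` B \<inter> space M))"
    if [measurable]: "Z \<in> borel_measurable M" for Z :: "'a \<Rightarrow> real"
    by (subst plus_emeasure) (auto intro!: arg_cong[where f = "emeasure M"])
  let ?Z = "\<lambda>\<omega>. if \<omega> \<in> A then V \<omega> else X \<omega>"
  have "A \<inter> (?Z -` B \<inter> space M) = A \<inter> (V -` B \<inter> space M)"
    "(space M - A) \<inter> (?Z -` B \<inter> space M) = (space M - A) \<inter> (X -` B \<inter> space M)"
    by auto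
  then have "emeasure M (?Z -` B \<inter> space M) = emeasure M (X -` B \<inter> space M)"
    by (subst split, measurable) (simp add: split[of X] on)
  then show "emeasure (distr M borel ?Z) B = emeasure (distr M borel X) B"
    by (subst (1 2) emeasure_distr) auto
qed simp

text \<open>Under the conditional measure \<open>P\<close> on A a uniform \<open>U\<close> exists,
  and q applied to any rotation of \<open>U\<close> has the conditional law of X; pasting X back
  outside A restores the full law. The mean of the copies differs from the average only on A, by a
  Riemann sum error whose modular tends to 0.\<close>

lemma averages_of_copies:
  assumes orl: "orlicz \<Phi>" and na: "nonatomic M" and X: "X \<in> LPhi M \<Phi>"
    and A[measurable]: "A \<in> events" and pA: "prob A > 0"
  obtains m :: "nat \<Rightarrow> nat" and Xs :: "nat \<Rightarrow> nat \<Rightarrow> 'a \<Rightarrow> real" and D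
  where "\<And>k. m k > 0" "\<And>k j. j < m k \<Longrightarrow> Xs k j \<in> borel_measurable M"
    "\<And>k j. j < m k \<Longrightarrow> distr M borel (Xs k j) = distr M borel X"
    "AE \<omega> in M. (\<lambda>k. (\<Sum>j<m k. Xs k j \<omega>) / real (m k)) \<longlonglongrightarrow> avg M A X \<omega>"
    "D \<in> LPhi M \<Phi>" "\<And>k. AE \<omega> in M. \<bar>(\<Sum>j<m k. Xs k j \<omega>) / real (m k)\<bar> \<le> D \<omega>"
proof -
  interpret orlicz \<Phi> by fact
  note X_meas[measurable] = LPhi_measurable[OF X]
  obtain l where l: "l > 0" and Xfin: "(\<integral>\<^sup>+x. ennreal (\<Phi> (\<bar>X x\<bar> / l)) \<partial>M) < \<infinity>"
    using X by (rule LPhiE)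
  define P where "P = uniform_measure M A"
  have eA: "emeasure M A \<noteq> 0" "emeasure M A \<noteq> \<infinity>"
    using pA by (auto simp: emeasure_eq_measure)
  interpret P: prob_space P
    unfolding P_def using eA by (intro prob_space_uniform_measure)
  have sets_P[measurable_cong, simp]: "sets P = sets M" by (simp add: P_def)
  have meas_P[simp]: "borel_measurable P = borel_measurable M"
    by (intro measurable_cong_sets) auto
  have "nonatomic P"
    unfolding P_def by (rule nonatomic_uniform_measure[OF na A pA])
  then obtain U where U_meas[measurable]: "U \<in> borel_measurable M" and U: "distr P borel U = unif"
    using P.nonatomic_uniform by auto
  have "real_distribution (distr P borel X)"
    by (simp add: P.real_distribution_distr)
  then obtain q where q_meas[measurable]: "q \<in> borel_measurable borel" and q: "mono_on {0<..<1} q"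
    and qX: "distr unif borel q = distr P borel X"
    by (rule quantile_exists)
  have frac_meas[measurable]: "(\<lambda>u::real. frac u) \<in> borel_measurable borel"
    by (simp add: frac_def)
  define R where "R N j u = frac (u + real j / real N)" for N j :: nat and u :: real
  have R_meas[measurable]: "R N j \<in> borel_measurable borel" for N j
    unfolding R_def by measurable
  define Y where "Y N j \<omega> = (if \<omega> \<in> A then q (R N j (U \<omega>)) else X \<omega>)" for N j \<omega>
  have Y_meas[measurable]: "Y N j \<in> borel_measurable M" for N j
    unfolding Y_def by measurable
  have Y_distr: "distr M borel (Y N j) = distr M borel X" if "j < N" for N j
  proof -
    have rot: "distr unif borel (R N j) = unif"
      unfolding R_def using that by (intro distr_unif_rotate) auto
    have "distr P borel (\<lambda>\<omega>. q (R N j (U \<omega>))) = distr (distr (distr P borel U) borel (R N j)) borel q"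
      by (subst (1 2) distr_distr) (auto simp: comp_def)
    also have "\<dots> = distr P borel X"
      by (simp add: U rot qX)
    finally have "distr P borel (\<lambda>\<omega>. q (R N j (U \<omega>))) = distr P borel X" .
    then show ?thesis
      unfolding Y_def P_def by (intro distr_glue A pA) auto
  qed
  define c where "c = (\<integral>x. indicator A x * X x \<partial>M) / prob A"
  \<comment> \<open>The limit of the Riemann sums is the integral of the quantile function, which is
    the conditional mean of X on A.\<close>
  have c_q: "c = (\<integral>u. q u \<partial>unif)"
  proof -
    have "c = (\<integral>x. X x \<partial>P)"
      unfolding c_def P_def using pA by (simp add: integral_uniform_measure)
    also have "\<dots> = (\<integral>x. x \<partial>distr P borel X)"
      by (subst integral_distr) auto
    also have "\<dots> = (\<integral>u. q u \<partial>unif)"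
      unfolding qX[symmetric] by (subst integral_distr) auto
    finally show ?thesis .
  qed
  have nnP: "(\<integral>\<^sup>+x. f x \<partial>P) = (\<integral>\<^sup>+x. f x * indicator A x \<partial>M) / emeasure M A"
    if "f \<in> borel_measurable M" for f
    unfolding P_def using that by (intro nn_integral_uniform_measure) auto
  have q_fin: "(\<integral>\<^sup>+u. ennreal (\<Phi> (\<bar>q u\<bar> / l)) \<partial>unif) < \<infinity>"
  proof -
    have "(\<integral>\<^sup>+u. ennreal (\<Phi> (\<bar>q u\<bar> / l)) \<partial>unif) = (\<integral>\<^sup>+x. ennreal (\<Phi> (\<bar>x\<bar> / l)) \<partial>distr unif borel q)"
      using l by (subst nn_integral_distr) auto
    also have "\<dots> = (\<integral>\<^sup>+x. ennreal (\<Phi> (\<bar>X x\<bar> / l)) \<partial>P)"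
      unfolding qX using l by (subst nn_integral_distr) auto
    also have "\<dots> = (\<integral>\<^sup>+x. ennreal (\<Phi> (\<bar>X x\<bar> / l)) * indicator A x \<partial>M) / emeasure M A"
      using l by (intro nnP) measurable
    also have "\<dots> < \<infinity>"
    proof -
      have "(\<integral>\<^sup>+x. ennreal (\<Phi> (\<bar>X x\<bar> / l)) * indicator A x \<partial>M) < \<infinity>"
        by (rule le_less_trans[OF nn_integral_mono Xfin]) (auto simp: indicator_def)
      then show ?thesis
        using eA by (simp add: ennreal_divide_eq_top_iff less_top[symmetric])
    qed
    finally show ?thesis .
  qed
  define S where "S N u = (\<Sum>j<N. q (R N j u)) / real N" for N u
  have S_meas[measurable]: "S N \<in> borel_measurable borel" for N
    unfolding S_def by measurable
  have S_lim: "(\<lambda>N. \<integral>\<^sup>+u. ennreal (\<Phi> (\<bar>S N u - c\<bar> / (2 * l))) \<partial>unif) \<longlonglongrightarrow> 0"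
    using rotation_averages_modular_tendsto[OF q q_meas l q_fin] unfolding c_q S_def R_def .
  \<comment> \<open>The index is shifted by one so that the number of copies is never 0.\<close>
  define Z where "Z N \<omega> = (\<Sum>j<Suc N. Y (Suc N) j \<omega>) / real (Suc N) - avg M A X \<omega>" for N \<omega>
  have Z_meas[measurable]: "Z N \<in> borel_measurable M" for N
    unfolding Z_def by measurable
  have Z_eq: "Z N \<omega> = (if \<omega> \<in> A then S (Suc N) (U \<omega>) - c else 0)" for N \<omega>
    by (simp add: Z_def Y_def S_def avg_def c_def del: sum.lessThan_Suc)
  have Z_le: "(\<integral>\<^sup>+\<omega>. ennreal (\<Phi> (\<bar>Z N \<omega>\<bar> / (2 * l))) \<partial>M) \<le> (\<integral>\<^sup>+u. ennreal (\<Phi> (\<bar>S (Suc N) u - c\<bar> / (2 * l))) \<partial>unif)" for N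
  proof -
    let ?f = "\<lambda>\<omega>. ennreal (\<Phi> (\<bar>S (Suc N) (U \<omega>) - c\<bar> / (2 * l)))"
    have l2: "0 < 2 * l" using l by simp
    have f_meas: "?f \<in> borel_measurable M" using l2 by measurable
    have "(\<integral>\<^sup>+\<omega>. ennreal (\<Phi> (\<bar>Z N \<omega>\<bar> / (2 * l))) \<partial>M) = (\<integral>\<^sup>+\<omega>. ?f \<omega> * indicator A \<omega> \<partial>M)"
      by (intro nn_integral_cong) (auto simp: Z_eq)
    \<comment> \<open>Passing to the conditional measure divides by \<open>prob A\<close>, which is
      at most 1 and therefore only enlarges the integral.\<close>
    also have "\<dots> \<le> (\<integral>\<^sup>+\<omega>. ?f \<omega> * indicator A \<omega> \<partial>M) / emeasure M A"
    proof -
      have "ennreal 1 \<le> ennreal (inverse (prob A))"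
        using pA by (intro ennreal_leI) (simp add: one_le_inverse)
      then have "(\<integral>\<^sup>+\<omega>. ?f \<omega> * indicator A \<omega> \<partial>M) * 1 \<le> (\<integral>\<^sup>+\<omega>. ?f \<omega> * indicator A \<omega> \<partial>M) * ennreal (inverse (prob A))"
        by (intro mult_left_mono) auto
      then show ?thesis
        using pA by (simp add: divide_ennreal_def emeasure_eq_measure inverse_ennreal)
    qed
    also have "\<dots> = (\<integral>\<^sup>+\<omega>. ?f \<omega> \<partial>P)"
      by (rule nnP[OF f_meas, symmetric])
    also have "\<dots> = (\<integral>\<^sup>+u. ennreal (\<Phi> (\<bar>S (Suc N) u - c\<bar> / (2 * l))) \<partial>distr P borel U)"
      using l by (subst nn_integral_distr) auto
    finally show ?thesis unfolding U .
  qed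
  have Z_lim: "(\<lambda>N. \<integral>\<^sup>+\<omega>. ennreal (\<Phi> (\<bar>Z N \<omega>\<bar> / (2 * l))) \<partial>M) \<longlonglongrightarrow> 0"
    by (rule tendsto_sandwich[OF _ _ tendsto_const LIMSEQ_Suc[OF S_lim]]) (auto simp: Z_le)
  obtain r :: "nat \<Rightarrow> nat" and D where r: "strict_mono r" and D: "D \<in> LPhi M \<Phi>"
    and conv: "AE \<omega> in M. (\<lambda>k. Z (r k) \<omega>) \<longlonglongrightarrow> 0"
    and dom: "\<And>k. AE \<omega> in M. \<bar>Z (r k) \<omega>\<bar> \<le> D \<omega>"
    by (rule modular_subsequence[of Z M "2 * l", OF Z_meas _ Z_lim]) (use l in auto)
  have Y_Z: "(\<Sum>j<Suc N. Y (Suc N) j \<omega>) / real (Suc N) = Z N \<omega> + avg M A X \<omega>" for N \<omega>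
    by (simp add: Z_def)
  have const: "(\<lambda>_. \<bar>c\<bar>) \<in> LPhi M \<Phi>"
    by (rule subsetD[OF Linf_subset_LPhi[OF orl]]) (auto simp: Linf_def)
  have absX: "(\<lambda>\<omega>. \<bar>X \<omega>\<bar>) \<in> LPhi M \<Phi>"
    by (rule LPhi_mono[OF X]) auto
  show ?thesis
  \<comment> \<open>\<open>D\<close> dominates the error, and |X| + |c| dominates the average
    itself: c on A, X outside.\<close>
  proof (rule that[of "\<lambda>k. Suc (r k)" "\<lambda>k. Y (Suc (r k))" "\<lambda>\<omega>. \<bar>X \<omega>\<bar> + (\<bar>c\<bar> + D \<omega>)"])
    show "(\<lambda>\<omega>. \<bar>X \<omega>\<bar> + (\<bar>c\<bar> + D \<omega>)) \<in> LPhi M \<Phi>"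
      by (intro LPhi_add absX const D)
    show "AE \<omega> in M. (\<lambda>k. (\<Sum>j<Suc (r k). Y (Suc (r k)) j \<omega>) / real (Suc (r k))) \<longlonglongrightarrow> avg M A X \<omega>"
      using conv
    proof eventually_elim
      case (elim \<omega>)
      from tendsto_add[OF this tendsto_const, of "avg M A X \<omega>"] show ?case
        unfolding Y_Z by simp
    qed
    show "AE \<omega> in M. \<bar>(\<Sum>j<Suc (r k). Y (Suc (r k)) j \<omega>) / real (Suc (r k))\<bar> \<le> \<bar>X \<omega>\<bar> + (\<bar>c\<bar> + D \<omega>)" for k
      using dom[of k]
    proof eventually_elim
      case (elim \<omega>)
      have "\<bar>avg M A X \<omega>\<bar> \<le> \<bar>X \<omega>\<bar> + \<bar>c\<bar>"
        by (auto simp: avg_def c_def)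
      with elim show ?case
        unfolding Y_Z by linarith
    qed
  qed (auto simp: Y_distr)
qed

section \<open>Averages over tails\<close>

lemma tail_avg_Linf:
  assumes X: "X \<in> borel_measurable M" shows "tail_avg M n X \<in> Linf M"
proof -
  let ?c = "(\<integral>x. indicator (tail M n X) x * X x \<partial>M) / prob (tail M n X)"
  have "\<bar>tail_avg M n X \<omega>\<bar> \<le> max (real n) \<bar>?c\<bar>" if "\<omega> \<in> space M" for \<omega>
  proof (cases "\<omega> \<in> tail M n X")
    case True
    then show ?thesis by (simp add: tail_avg_def avg_def)
  next
    case False
    then have "\<bar>X \<omega>\<bar> \<le> real n" using that by (simp add: tail_def)
    with False show ?thesis by (simp add: tail_avg_def avg_def)
  qed
  then have "AE \<omega> in M. \<bar>tail_avg M n X \<omega>\<bar> \<le> max (real n) \<bar>?c\<bar>" by (intro AE_I2)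
  with X show ?thesis unfolding Linf_def by (auto simp del: max.bounded_iff)
qed

text \<open>The tail average is a Borel function g of X, where g is built from the law of X alone:
  both the tail and the mean over it can be read off that law. Equal laws thus give the same g and
  equal image laws.\<close>

lemma tail_avg_distr:
  assumes X[measurable]: "X \<in> borel_measurable M" and Y[measurable]: "Y \<in> borel_measurable M"
    and eq: "distr M borel X = distr M borel Y"
  shows "distr M borel (tail_avg M n X) = distr M borel (tail_avg M n Y)"
proof -
  define B where "B = {x::real. real n < \<bar>x\<bar>}"
  have B[measurable]: "B \<in> sets borel" unfolding B_def by measurable
  define g where "g D x = (if x \<in> B then (\<integral>y. indicator B y * y \<partial>D) / measure D B else x)" for D :: "real measure" and x
  have g_meas: "g D \<in> borel_measurable borel" for D
    unfolding g_def by measurable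
  have *: "distr M borel (tail_avg M n Z) = distr (distr M borel Z) borel (g (distr M borel Z))"
    if Z[measurable]: "Z \<in> borel_measurable M" for Z
  proof -
    have tl: "tail M n Z = Z -` B \<inter> space M" by (auto simp: tail_def B_def)
    have m: "measure (distr M borel Z) B = prob (tail M n Z)"
      unfolding tl by (rule measure_distr) auto
    have i: "(\<integral>y. indicator B y * y \<partial>distr M borel Z) = (\<integral>x. indicator (tail M n Z) x * Z x \<partial>M)"
      by (subst integral_distr) (auto simp: tl intro!: Bochner_Integration.integral_cong split: split_indicator)
    have "distr (distr M borel Z) borel (g (distr M borel Z)) = distr M borel (\<lambda>\<omega>. g (distr M borel Z) (Z \<omega>))"
      using g_meas by (subst distr_distr) (auto simp: comp_def)
    also have "\<dots> = distr M borel (tail_avg M n Z)"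
      by (intro distr_cong) (auto simp: g_def m i tail_avg_def avg_def tl)
    finally show ?thesis ..
  qed
  show ?thesis by (simp add: * eq)
qed

text \<open>The error vanishes outside the tail and equals c - X on it, with c the tail mean. At the
  doubled scale its modular is at most that of c on the tail plus that of X on the tail, and
  Jensen's inequality bounds the first by the second, which tends to 0.\<close>

lemma tail_avg_approx:
  assumes orl: "orlicz \<Phi>" and X: "X \<in> LPhi M \<Phi>"
  obtains r :: "nat \<Rightarrow> nat" and D where "D \<in> LPhi M \<Phi>"
    "AE \<omega> in M. (\<lambda>k. tail_avg M (r k) X \<omega>) \<longlonglongrightarrow> X \<omega>"
    "\<And>k. AE \<omega> in M. \<bar>tail_avg M (r k) X \<omega>\<bar> \<le> D \<omega>"
proof -
  interpret orlicz \<Phi> by fact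
  note X_meas[measurable] = LPhi_measurable[OF X]
  obtain l where l: "l > 0" and fin: "(\<integral>\<^sup>+x. ennreal (\<Phi> (\<bar>X x\<bar> / l)) \<partial>M) < \<infinity>"
    using X by (rule LPhiE)
  define T where "T n = (\<integral>\<^sup>+x. ennreal (\<Phi> (\<bar>X x\<bar> / l)) * indicator {x. real n < \<bar>X x\<bar>} x \<partial>M)" for n
  have T: "T \<longlonglongrightarrow> 0"
    unfolding T_def using l fin by (intro tendsto_nn_integral_tail filterlim_real_sequentially) auto
  define Z where "Z n \<omega> = tail_avg M n X \<omega> - X \<omega>" for n \<omega>
  have Z_meas[measurable]: "Z n \<in> borel_measurable M" for n
    unfolding Z_def by measurable
  have Z_le: "(\<integral>\<^sup>+\<omega>. ennreal (\<Phi> (\<bar>Z n \<omega>\<bar> / (2 * l))) \<partial>M) \<le> T n + T n" for n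
  proof -
    define A where "A = tail M n X"
    have A[measurable]: "A \<in> events" unfolding A_def by measurable
    have T_A: "T n = (\<integral>\<^sup>+x. ennreal (\<Phi> (\<bar>X x\<bar> / l)) * indicator A x \<partial>M)"
      unfolding T_def A_def tail_def by (intro nn_integral_cong) (auto simp: indicator_def)
    define c where "c = (\<integral>x. indicator A x * X x \<partial>M) / prob A"
    have jensen: "ennreal (\<Phi> (\<bar>c\<bar> / l)) * emeasure M A \<le> T n"
    proof (cases "prob A > 0")
      case True
      then have eA: "emeasure M A \<noteq> 0" "emeasure M A \<noteq> \<infinity>" by (auto simp: emeasure_eq_measure)
      have P: "prob_space (uniform_measure M A)"
        using eA by (intro prob_space_uniform_measure)
      have nn: "(\<integral>\<^sup>+x. ennreal (\<Phi> (\<bar>X x\<bar> / l)) \<partial>uniform_measure M A) = T n / emeasure M A"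
        unfolding T_A using l by (intro nn_integral_uniform_measure) auto
      have "T n < \<infinity>"
        unfolding T_A by (rule le_less_trans[OF nn_integral_mono fin]) (auto simp: indicator_def)
      then have "T n / emeasure M A < \<infinity>"
        using eA by (simp add: ennreal_divide_eq_top_iff less_top[symmetric])
      moreover have "AE x in uniform_measure M A. X x \<noteq> 0"
        by (intro AE_uniform_measureI) (auto simp: A_def tail_def)
      ultimately have "ennreal (\<Phi> (\<bar>\<integral>x. X x \<partial>uniform_measure M A\<bar> / l)) \<le> T n / emeasure M A"
        using jensen_integral[OF P _ l, of X] by (simp add: nn)
      then have "ennreal (\<Phi> (\<bar>c\<bar> / l)) \<le> T n / emeasure M A"
        unfolding c_def using True by (simp add: integral_uniform_measure)
      then have "ennreal (\<Phi> (\<bar>c\<bar> / l)) * emeasure M A \<le> T n / emeasure M A * emeasure M A"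
        by (rule mult_right_mono) simp
      also have "\<dots> = T n"
        using eA by (simp add: ennreal_divide_times ennreal_divide_self less_top[symmetric])
      finally show ?thesis .
    next
      case False
      then have "emeasure M A = 0" by (simp add: emeasure_eq_measure not_less measure_le_0_iff)
      then show ?thesis by simp
    qed
    have "(\<integral>\<^sup>+\<omega>. ennreal (\<Phi> (\<bar>Z n \<omega>\<bar> / (2 * l))) \<partial>M)
        \<le> (\<integral>\<^sup>+\<omega>. ennreal (\<Phi> (\<bar>c\<bar> / l)) * indicator A \<omega> + ennreal (\<Phi> (\<bar>X \<omega>\<bar> / l)) * indicator A \<omega> \<partial>M)"
    proof (intro nn_integral_mono)
      fix \<omega>
      show "ennreal (\<Phi> (\<bar>Z n \<omega>\<bar> / (2 * l))) \<le> ennreal (\<Phi> (\<bar>c\<bar> / l)) * indicator A \<omega> + ennreal (\<Phi> (\<bar>X \<omega>\<bar> / l)) * indicator A \<omega>"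
      proof (cases "\<omega> \<in> A")
        case True
        then have "Z n \<omega> = c + - X \<omega>"
          by (simp add: Z_def tail_avg_def avg_def A_def c_def)
        then have "ennreal (\<Phi> (\<bar>Z n \<omega>\<bar> / (2 * l))) \<le> ennreal (\<Phi> (\<bar>c\<bar> / l) + \<Phi> (\<bar>X \<omega>\<bar> / l))"
          using abs_add_le[OF l, of c "- X \<omega>"] by (intro ennreal_leI) simp
        also have "\<dots> = ennreal (\<Phi> (\<bar>c\<bar> / l)) + ennreal (\<Phi> (\<bar>X \<omega>\<bar> / l))"
          using l by (intro ennreal_plus nonneg) auto
        finally show ?thesis using True by simp
      qed (simp add: Z_def tail_avg_def avg_def A_def)
    qed
    also have "\<dots> = ennreal (\<Phi> (\<bar>c\<bar> / l)) * emeasure M A + T n"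
      unfolding T_A using l by (subst nn_integral_add) (auto simp: nn_integral_cmult_indicator)
    also have "\<dots> \<le> T n + T n"
      using jensen by (intro add_mono) auto
    finally show ?thesis .
  qed
  have T2: "(\<lambda>n. T n + T n) \<longlonglongrightarrow> 0"
    using tendsto_add[OF T T] by simp
  have Z_lim: "(\<lambda>n. \<integral>\<^sup>+\<omega>. ennreal (\<Phi> (\<bar>Z n \<omega>\<bar> / (2 * l))) \<partial>M) \<longlonglongrightarrow> 0"
    by (rule tendsto_sandwich[OF _ _ tendsto_const T2]) (auto simp: Z_le)
  obtain r :: "nat \<Rightarrow> nat" and D where "strict_mono r" and D: "D \<in> LPhi M \<Phi>"
    and conv: "AE \<omega> in M. (\<lambda>k. Z (r k) \<omega>) \<longlonglongrightarrow> 0"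
    and dom: "\<And>k. AE \<omega> in M. \<bar>Z (r k) \<omega>\<bar> \<le> D \<omega>"
    by (rule modular_subsequence[of Z M "2 * l", OF Z_meas _ Z_lim]) (use l in auto)
  have absX: "(\<lambda>\<omega>. \<bar>X \<omega>\<bar>) \<in> LPhi M \<Phi>"
    by (rule LPhi_mono[OF X]) auto
  show ?thesis
  proof (rule that)
    show "(\<lambda>\<omega>. \<bar>X \<omega>\<bar> + D \<omega>) \<in> LPhi M \<Phi>"
      by (intro LPhi_add absX D)
    show "AE \<omega> in M. (\<lambda>k. tail_avg M (r k) X \<omega>) \<longlonglongrightarrow> X \<omega>"
      using conv
    proof eventually_elim
      case (elim \<omega>)
      from tendsto_add[OF this tendsto_const, of "X \<omega>"] show ?case by (simp add: Z_def)
    qed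
    show "AE \<omega> in M. \<bar>tail_avg M (r k) X \<omega>\<bar> \<le> \<bar>X \<omega>\<bar> + D \<omega>" for k
      using dom[of k] by eventually_elim (auto simp: Z_def)
  qed
qed

end

section \<open>Extension of functionals\<close>

definition admissible :: "'a measure \<Rightarrow> ('a \<Rightarrow> real) set \<Rightarrow> (('a \<Rightarrow> real) \<Rightarrow> ereal) \<Rightarrow> bool" where
  "admissible M E f \<longleftrightarrow> proper_on E f \<and> convex_fun_on E f \<and> law_invariant_on M E f \<and> fatou_on M E f"

lemma admissible_not_MInf: "admissible M E f \<Longrightarrow> X \<in> E \<Longrightarrow> f X \<noteq> -\<infinity>"
  by (simp add: admissible_def proper_on_def)

lemma admissible_convex:
  assumes "admissible M E f" "X \<in> E" "Y \<in> E" "0 \<le> a" "a \<le> 1"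
  shows "f (\<lambda>\<omega>. a * X \<omega> + (1 - a) * Y \<omega>) \<le> ereal a * f X + ereal (1 - a) * f Y"
  using assms unfolding admissible_def convex_fun_on_def by blast

lemma admissible_law:
  "admissible M E f \<Longrightarrow> X \<in> E \<Longrightarrow> Y \<in> E \<Longrightarrow> distr M borel X = distr M borel Y \<Longrightarrow> f X = f Y"
  unfolding admissible_def law_invariant_on_def by blast

lemma admissible_fatou:
  assumes "admissible M E f" "\<And>n. Xs n \<in> E" "X \<in> E" "Y \<in> E"
    "AE \<omega> in M. (\<lambda>n. Xs n \<omega>) \<longlonglongrightarrow> X \<omega>" "\<And>n. AE \<omega> in M. \<bar>Xs n \<omega>\<bar> \<le> Y \<omega>"
  shows "f X \<le> liminf (\<lambda>n. f (Xs n))"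
  using assms unfolding admissible_def fatou_on_def by blast

lemma liminf_le_SUP:
  fixes u :: "nat \<Rightarrow> ereal"
  assumes "\<And>n. u n \<le> S" shows "liminf u \<le> S"
proof -
  have "liminf u \<le> liminf (\<lambda>_. S)"
    by (intro Liminf_mono always_eventually allI assms)
  then show ?thesis by (simp add: Liminf_const)
qed

text \<open>Sublevel sets of a convex functional are convex, hence closed under equal-weight means.
  A common bound c in place of a sum of values avoids arithmetic with infinite values; the intended
  c is the value shared by equidistributed copies.\<close>

lemma sublevel_average:
  fixes f :: "('a \<Rightarrow> real) \<Rightarrow> ereal"
  assumes f: "convex_fun_on E f"
    and E: "\<And>X Y a. X \<in> E \<Longrightarrow> Y \<in> E \<Longrightarrow> 0 \<le> a \<Longrightarrow> a \<le> 1 \<Longrightarrow> (\<lambda>\<omega>. a * X \<omega> + (1 - a) * Y \<omega>) \<in> E"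
    and c: "c \<noteq> -\<infinity>" and n: "n > 0"
    and Xs: "\<And>j. j < n \<Longrightarrow> Xs j \<in> E" "\<And>j. j < n \<Longrightarrow> f (Xs j) \<le> c"
  shows "(\<lambda>\<omega>. (\<Sum>j<n. Xs j \<omega>) / real n) \<in> E \<and> f (\<lambda>\<omega>. (\<Sum>j<n. Xs j \<omega>) / real n) \<le> c"
proof -
  have sub: "f (\<lambda>\<omega>. a * X \<omega> + (1 - a) * Y \<omega>) \<le> c"
    if "X \<in> E" "Y \<in> E" "f X \<le> c" "f Y \<le> c" "0 \<le> a" "a \<le> 1" for X Y a
  proof -
    have "f (\<lambda>\<omega>. a * X \<omega> + (1 - a) * Y \<omega>) \<le> ereal a * f X + ereal (1 - a) * f Y"
      using f that by (auto simp: convex_fun_on_def)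
    also have "\<dots> \<le> ereal a * c + ereal (1 - a) * c"
      using that by (intro add_mono ereal_mult_left_mono) auto
    also have "\<dots> = c"
    proof (cases c)
      case (real x)
      then show ?thesis by (simp add: algebra_simps)
    next
      case PInf
      then show ?thesis using that by (cases "a = 0"; cases "a = 1") auto
    qed (use c in simp)
    finally show ?thesis .
  qed
  have "(\<lambda>\<omega>. (\<Sum>j<Suc m. Xs j \<omega>) / real (Suc m)) \<in> E \<and> f (\<lambda>\<omega>. (\<Sum>j<Suc m. Xs j \<omega>) / real (Suc m)) \<le> c"
    if "m < n" for m
    using that
  proof (induction m)
    case 0
    then show ?case using Xs[of 0] by simp
  next
    case (Suc m)
    \<comment> \<open>The mean of m + 2 terms puts weight (m + 1) / (m + 2) on the mean of the
      earlier m + 1 terms.\<close>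
    define a where "a = real (Suc m) / real (Suc (Suc m))"
    have a: "0 \<le> a" "a \<le> 1" by (auto simp: a_def)
    have 1: "1 - a = 1 / real (Suc (Suc m))"
      by (simp add: a_def field_simps)
    have eq: "(\<lambda>\<omega>. (\<Sum>j<Suc (Suc m). Xs j \<omega>) / real (Suc (Suc m)))
        = (\<lambda>\<omega>. a * ((\<Sum>j<Suc m. Xs j \<omega>) / real (Suc m)) + (1 - a) * Xs (Suc m) \<omega>)"
    proof
      fix \<omega>
      have "a * ((\<Sum>j<Suc m. Xs j \<omega>) / real (Suc m)) = (\<Sum>j<Suc m. Xs j \<omega>) / real (Suc (Suc m))"
        by (simp add: a_def del: of_nat_Suc sum.lessThan_Suc)
      then show "(\<Sum>j<Suc (Suc m). Xs j \<omega>) / real (Suc (Suc m))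
          = a * ((\<Sum>j<Suc m. Xs j \<omega>) / real (Suc m)) + (1 - a) * Xs (Suc m) \<omega>"
        unfolding 1 by (subst sum.lessThan_Suc) (simp add: add_divide_distrib del: sum.lessThan_Suc of_nat_Suc)
    qed
    show ?case
      unfolding eq using Suc Xs[of "Suc m"] a by (intro conjI E sub) auto
  qed
  from this[of "n - 1"] n show ?thesis by simp
qed

section \<open>Compositions of averages over a list of events\<close>

definition iter_avg :: "'a measure \<Rightarrow> 'a set list \<Rightarrow> ('a \<Rightarrow> real) \<Rightarrow> 'a \<Rightarrow> real" where
  "iter_avg M As X = foldr (avg M) As X"

lemma iter_avg_simps[simp]:
  "iter_avg M [] X = X" "iter_avg M (A # As) X = avg M A (iter_avg M As X)"
  by (simp_all add: iter_avg_def)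

text \<open>The end of the list acts on X before the rest. A tail event put at the end of a cover
  therefore turns X into its tail average before the cover acts.\<close>

lemma iter_avg_append: "iter_avg M (As @ Bs) X = iter_avg M As (iter_avg M Bs X)"
  by (simp add: iter_avg_def)

text \<open>The events of a cover may overlap. After averaging over all of them every integrable variable is
  bounded, whatever the order.\<close>

definition covers :: "'a measure \<Rightarrow> 'a set list set" where
  "covers M = {As. set As \<subseteq> sets M \<and> \<Union>(set As) = space M}"

lemma iter_avg_measurable:
  "X \<in> borel_measurable M \<Longrightarrow> set As \<subseteq> sets M \<Longrightarrow> iter_avg M As X \<in> borel_measurable M"
  by (induction As) auto

context prob_space
begin

lemma Linf_integrable:
  assumes "X \<in> Linf M" shows "integrable M X"
proof -
  obtain C where "X \<in> borel_measurable M" "AE x in M. \<bar>X x\<bar> \<le> C"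
    using assms by (auto simp: Linf_def)
  then show ?thesis by (intro integrable_const_bound[of X C]) auto
qed

lemma Linf_convex:
  assumes "X \<in> Linf M" "Y \<in> Linf M" shows "(\<lambda>\<omega>. a * X \<omega> + b * Y \<omega>) \<in> Linf M"
proof -
  obtain C D where [measurable]: "X \<in> borel_measurable M" "Y \<in> borel_measurable M"
    and C: "AE x in M. \<bar>X x\<bar> \<le> C" and D: "AE x in M. \<bar>Y x\<bar> \<le> D"
    using assms by (auto simp: Linf_def)
  have "AE x in M. \<bar>a * X x + b * Y x\<bar> \<le> \<bar>a\<bar> * C + \<bar>b\<bar> * D"
    using C D
  proof eventually_elim
    case (elim x)
    have "\<bar>a * X x + b * Y x\<bar> \<le> \<bar>a\<bar> * \<bar>X x\<bar> + \<bar>b\<bar> * \<bar>Y x\<bar>"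
      by (metis abs_mult abs_triangle_ineq)
    also have "\<dots> \<le> \<bar>a\<bar> * C + \<bar>b\<bar> * D"
      using elim by (intro add_mono mult_left_mono) auto
    finally show ?case .
  qed
  then show ?thesis by (auto simp: Linf_def)
qed

lemma Linf_distr:
  assumes X: "X \<in> Linf M" and Y: "Y \<in> borel_measurable M" and eq: "distr M borel X = distr M borel Y"
  shows "Y \<in> Linf M"
proof -
  obtain C where X_meas: "X \<in> borel_measurable M" and C: "AE x in M. \<bar>X x\<bar> \<le> C"
    using X by (auto simp: Linf_def)
  have "AE x in distr M borel X. \<bar>x\<bar> \<le> C"
    using C X_meas by (subst AE_distr_iff) auto
  then have "AE x in M. \<bar>Y x\<bar> \<le> C"
    unfolding eq using Y by (subst (asm) AE_distr_iff) auto
  with Y show ?thesis by (auto simp: Linf_def)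
qed

lemma avg_Linf:
  assumes X: "X \<in> Linf M" and A: "A \<in> events" shows "avg M A X \<in> Linf M"
proof -
  obtain C where [measurable]: "X \<in> borel_measurable M" and C: "AE x in M. \<bar>X x\<bar> \<le> C"
    using X by (auto simp: Linf_def)
  have "AE \<omega> in M. \<bar>avg M A X \<omega>\<bar> \<le> max C \<bar>(\<integral>x. indicator A x * X x \<partial>M) / prob A\<bar>"
    using C by eventually_elim (auto simp: avg_def)
  with A show ?thesis by (auto simp: Linf_def simp del: max.bounded_iff)
qed

lemma avg_integrable:
  assumes X: "integrable M X" and A[measurable]: "A \<in> events" shows "integrable M (avg M A X)"
proof -
  have [measurable]: "X \<in> borel_measurable M" using X by auto
  have "AE \<omega> in M. norm (avg M A X \<omega>) \<le> norm (\<bar>X \<omega>\<bar> + \<bar>(\<integral>x. indicator A x * X x \<partial>M) / prob A\<bar>)"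
    by (intro AE_I2) (auto simp: avg_def)
  moreover have "integrable M (\<lambda>\<omega>. \<bar>X \<omega>\<bar> + \<bar>(\<integral>x. indicator A x * X x \<partial>M) / prob A\<bar>)"
    using X by (intro Bochner_Integration.integrable_add integrable_abs) auto
  ultimately show ?thesis
    by (intro Bochner_Integration.integrable_bound[where g = "avg M A X"]) auto
qed

text \<open>Linearity holds because A is fixed; \<open>tail_avg\<close>, whose event depends on X,
  does not have it.\<close>

lemma avg_linear:
  assumes X: "integrable M X" and Y: "integrable M Y" and A: "A \<in> events"
  shows "avg M A (\<lambda>\<omega>. a * X \<omega> + b * Y \<omega>) = (\<lambda>\<omega>. a * avg M A X \<omega> + b * avg M A Y \<omega>)"
proof -
  have i: "integrable M (\<lambda>x. indicator A x * X x)" "integrable M (\<lambda>x. indicator A x * Y x)"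
    using integrable_real_mult_indicator[OF A X] integrable_real_mult_indicator[OF A Y]
    by (simp_all add: mult.commute)
  have "(\<integral>x. indicator A x * (a * X x + b * Y x) \<partial>M)
      = (\<integral>x. a * (indicator A x * X x) + b * (indicator A x * Y x) \<partial>M)"
    by (intro Bochner_Integration.integral_cong) (auto simp: algebra_simps)
  also have "\<dots> = a * (\<integral>x. indicator A x * X x \<partial>M) + b * (\<integral>x. indicator A x * Y x \<partial>M)"
    using i by simp
  finally show ?thesis
    by (auto simp: avg_def fun_eq_iff add_divide_distrib)
qed

text \<open>The new majorant is the average of the old one, so the statement can be iterated along a
  list.\<close>

lemma avg_dominated:
  assumes [measurable]: "A \<in> events" "\<And>n. Xs n \<in> borel_measurable M" "X \<in> borel_measurable M"
    and Y: "integrable M Y"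
    and conv: "AE \<omega> in M. (\<lambda>n. Xs n \<omega>) \<longlonglongrightarrow> X \<omega>" and dom: "\<And>n. AE \<omega> in M. \<bar>Xs n \<omega>\<bar> \<le> Y \<omega>"
  shows "AE \<omega> in M. (\<lambda>n. avg M A (Xs n) \<omega>) \<longlonglongrightarrow> avg M A X \<omega>"
    and "AE \<omega> in M. \<bar>avg M A (Xs n) \<omega>\<bar> \<le> avg M A Y \<omega>"
proof -
  have [measurable]: "Y \<in> borel_measurable M" using Y by auto
  have iY: "integrable M (\<lambda>x. indicator A x * Y x)"
    using integrable_real_mult_indicator[OF _ Y, of A] by (simp add: mult.commute)
  have "(\<lambda>n. \<integral>x. indicator A x * Xs n x \<partial>M) \<longlonglongrightarrow> (\<integral>x. indicator A x * X x \<partial>M)"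
  proof (rule integral_dominated_convergence[OF _ _ iY])
    show "AE x in M. (\<lambda>n. indicator A x * Xs n x) \<longlonglongrightarrow> indicator A x * X x"
      using conv by eventually_elim (rule tendsto_mult_left)
    show "AE x in M. norm (indicator A x * Xs n x) \<le> indicator A x * Y x" for n
      using dom[of n] by eventually_elim (auto simp: indicator_def)
  qed auto
  then have c: "(\<lambda>n. (\<integral>x. indicator A x * Xs n x \<partial>M) / prob A) \<longlonglongrightarrow> (\<integral>x. indicator A x * X x \<partial>M) / prob A"
    unfolding divide_inverse by (rule tendsto_mult_right)
  show "AE \<omega> in M. (\<lambda>n. avg M A (Xs n) \<omega>) \<longlonglongrightarrow> avg M A X \<omega>"
    using conv by eventually_elim (use c in \<open>auto simp: avg_def\<close>)
  have "\<bar>\<integral>x. indicator A x * Xs n x \<partial>M\<bar> \<le> (\<integral>x. indicator A x * Y x \<partial>M)"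
  proof -
    have "AE x in M. \<bar>indicator A x * Xs n x\<bar> \<le> indicator A x * Y x"
      using dom[of n] by eventually_elim (auto simp: indicator_def)
    moreover have "integrable M (\<lambda>x. indicator A x * Xs n x)"
      by (rule Bochner_Integration.integrable_bound[OF iY]) (use calculation in \<open>auto elim!: eventually_mono\<close>)
    ultimately show ?thesis
      using iY by (intro order_trans[OF integral_abs_bound] integral_mono_AE) auto
  qed
  then have "\<bar>(\<integral>x. indicator A x * Xs n x \<partial>M) / prob A\<bar> \<le> (\<integral>x. indicator A x * Y x \<partial>M) / prob A"
    by (simp add: abs_divide divide_right_mono)
  then show "AE \<omega> in M. \<bar>avg M A (Xs n) \<omega>\<bar> \<le> avg M A Y \<omega>"
    using dom[of n] by (auto simp: avg_def elim!: eventually_mono)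
qed

lemma iter_avg_integrable:
  "integrable M X \<Longrightarrow> set As \<subseteq> events \<Longrightarrow> integrable M (iter_avg M As X)"
  by (induction As) (auto intro: avg_integrable)

lemma iter_avg_linear:
  assumes "integrable M X" "integrable M Y" "set As \<subseteq> events"
  shows "iter_avg M As (\<lambda>\<omega>. a * X \<omega> + b * Y \<omega>) = (\<lambda>\<omega>. a * iter_avg M As X \<omega> + b * iter_avg M As Y \<omega>)"
  using assms(3) by (induction As) (auto simp: avg_linear iter_avg_integrable assms(1,2))

lemma iter_avg_dominated:
  assumes "\<And>n. Xs n \<in> borel_measurable M" "X \<in> borel_measurable M" "integrable M Y"
    and "AE \<omega> in M. (\<lambda>n. Xs n \<omega>) \<longlonglongrightarrow> X \<omega>" "\<And>n. AE \<omega> in M. \<bar>Xs n \<omega>\<bar> \<le> Y \<omega>"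
    and "set As \<subseteq> events"
  shows "(AE \<omega> in M. (\<lambda>n. iter_avg M As (Xs n) \<omega>) \<longlonglongrightarrow> iter_avg M As X \<omega>) \<and>
    (\<forall>n. AE \<omega> in M. \<bar>iter_avg M As (Xs n) \<omega>\<bar> \<le> iter_avg M As Y \<omega>)"
  using assms(6)
proof (induction As)
  case (Cons A As)
  then have A: "A \<in> events" and As: "set As \<subseteq> events" by auto
  show ?case
    using avg_dominated[OF A, of "\<lambda>n. iter_avg M As (Xs n)" "iter_avg M As X" "iter_avg M As Y"]
      Cons.IH[OF As] iter_avg_measurable[OF _ As] iter_avg_integrable[OF assms(3) As] assms(1,2) by auto
qed (use assms in auto)

text \<open>By induction the result is bounded pointwise on the union of the events used: one more
  average inserts a constant on its event and leaves the other values alone. For a cover that union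
  is the whole space.\<close>

lemma iter_avg_Linf:
  assumes X: "X \<in> borel_measurable M" and As: "As \<in> covers M"
  shows "iter_avg M As X \<in> Linf M"
proof -
  have "\<exists>C. \<forall>\<omega>\<in>\<Union>(set Bs). \<bar>iter_avg M Bs X \<omega>\<bar> \<le> C" for Bs
  proof (induction Bs)
    case (Cons B Bs)
    then obtain C where "\<forall>\<omega>\<in>\<Union>(set Bs). \<bar>iter_avg M Bs X \<omega>\<bar> \<le> C" by blast
    then show ?case
      by (intro exI[of _ "max C \<bar>(\<integral>x. indicator B x * iter_avg M Bs X x \<partial>M) / prob B\<bar>"])
        (auto simp: avg_def le_max_iff_disj)
  qed auto
  then obtain C where "\<forall>\<omega>\<in>\<Union>(set As). \<bar>iter_avg M As X \<omega>\<bar> \<le> C" by blast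
  moreover have "\<Union>(set As) = space M"
    using As by (simp add: covers_def)
  ultimately have "AE \<omega> in M. \<bar>iter_avg M As X \<omega>\<bar> \<le> C"
    by (intro AE_I2) blast
  with X As show ?thesis by (auto simp: Linf_def covers_def iter_avg_measurable)
qed

text \<open>A mean of values within e of k is within e of k. Since closeness is measured to the
  reference g and not to the variable before averaging, the error does not accumulate over several
  averages.\<close>

lemma avg_near_const:
  assumes Z: "integrable M Z" and A[measurable]: "A \<in> events" and e: "0 \<le> e"
    and near: "AE \<omega> in M. \<bar>Z \<omega> - g \<omega>\<bar> \<le> e" and g: "\<And>\<omega>. \<omega> \<in> A \<Longrightarrow> g \<omega> = k"
  shows "AE \<omega> in M. \<bar>avg M A Z \<omega> - g \<omega>\<bar> \<le> e"
proof (cases "prob A = 0")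
  case True
  then have "AE \<omega> in M. \<omega> \<notin> A"
    by (intro AE_not_in) (auto simp: null_sets_def emeasure_eq_measure)
  with near show ?thesis by eventually_elim (simp add: avg_def)
next
  case False
  then have pA: "prob A > 0" by (simp add: zero_less_measure_iff)
  have iZ: "integrable M (\<lambda>x. indicator A x * Z x)"
    using integrable_real_mult_indicator[OF A Z] by (simp add: mult.commute)
  have i1: "integrable M (\<lambda>x. indicator A x * a)" for a :: real
    by (intro integrable_mult_left) (auto simp: emeasure_eq_measure)
  have "\<bar>\<integral>x. indicator A x * Z x - indicator A x * k \<partial>M\<bar> \<le> (\<integral>x. indicator A x * e \<partial>M)"
    using iZ i1 near e
    by (intro order_trans[OF integral_abs_bound] integral_mono_AE) (auto simp: g indicator_def elim!: eventually_mono)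
  then have "\<bar>(\<integral>x. indicator A x * Z x \<partial>M) - prob A * k\<bar> \<le> prob A * e"
    using iZ i1 by simp
  then have "\<bar>(\<integral>x. indicator A x * Z x \<partial>M) / prob A - k\<bar> \<le> e"
    using pA by (simp add: abs_le_iff field_simps)
  with near show ?thesis
    by (auto simp: avg_def g elim!: eventually_mono)
qed

text \<open>The cover consists of the level sets of g, which is X rounded down to multiples of 1 /
  n. Averaging over level sets stays within 1 / n of g, and g is within 1 / n of X; hence 2 /
  n.\<close>

lemma iter_avg_near:
  assumes X: "X \<in> Linf M" and n: "n > 0"
  obtains As where "As \<in> covers M" "AE \<omega> in M. \<bar>iter_avg M As X \<omega> - X \<omega>\<bar> \<le> 2 / real n"
proof -
  obtain C where X_meas[measurable]: "X \<in> borel_measurable M" and C: "AE x in M. \<bar>X x\<bar> \<le> C"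
    using X by (auto simp: Linf_def)
  define g where "g \<omega> = of_int \<lfloor>real n * X \<omega>\<rfloor> / real n" for \<omega>
  have gX: "\<bar>X \<omega> - g \<omega>\<bar> \<le> 1 / real n" for \<omega>
  proof -
    have "\<bar>real n * X \<omega> - of_int \<lfloor>real n * X \<omega>\<rfloor>\<bar> \<le> 1" by linarith
    then have "\<bar>real n * X \<omega> - of_int \<lfloor>real n * X \<omega>\<rfloor>\<bar> / real n \<le> 1 / real n"
      by (intro divide_right_mono) auto
    moreover have "X \<omega> - g \<omega> = (real n * X \<omega> - of_int \<lfloor>real n * X \<omega>\<rfloor>) / real n"
      using n by (simp add: g_def diff_divide_distrib)
    ultimately show ?thesis by (simp add: abs_divide)
  qed
  define m where "m = \<lceil>real n * C\<rceil> + 1"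
  define B where "B k = {\<omega> \<in> space M. \<lfloor>real n * X \<omega>\<rfloor> = k}" for k
  have B[measurable]: "B k \<in> events" for k
    unfolding B_def by measurable
  \<comment> \<open>Essential boundedness confines the levels met by X to -m..m up to a null event.
    \<open>R\<close> is that null remainder, added only to complete the cover.\<close>
  define R where "R = space M - (\<Union>k\<in>{-m..m}. B k)"
  have R[measurable]: "R \<in> events"
    unfolding R_def by (intro sets.compl_sets sets.finite_UN) (auto simp: B)
  define As where "As = map B [-m..m] @ [R]"
  have "As \<in> covers M"
    using sets.sets_into_space[OF B] by (auto simp: As_def covers_def B R) (auto simp: R_def)
  have X_int: "integrable M X" by (rule Linf_integrable[OF X])
  have "AE \<omega> in M. \<omega> \<notin> R"
    using C
  proof eventually_elim
    case (elim \<omega>)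
    have "\<bar>real n * X \<omega>\<bar> \<le> real n * C"
      using elim by (simp add: abs_mult mult_left_mono)
    then have "-m \<le> \<lfloor>real n * X \<omega>\<rfloor>" "\<lfloor>real n * X \<omega>\<rfloor> \<le> m"
      unfolding m_def by linarith+
    then show ?case by (auto simp: R_def B_def)
  qed
  then have base: "AE \<omega> in M. \<bar>avg M R X \<omega> - g \<omega>\<bar> \<le> 1 / real n"
    by eventually_elim (simp add: avg_def gX)
  have "AE \<omega> in M. \<bar>iter_avg M (map B ks) (avg M R X) \<omega> - g \<omega>\<bar> \<le> 1 / real n" for ks
  proof (induction ks)
    case (Cons k ks)
    have "integrable M (iter_avg M (map B ks) (avg M R X))"
      by (intro iter_avg_integrable avg_integrable X_int R) (auto simp: B)
    from avg_near_const[OF this B _ Cons, of k "real_of_int k / real n"] show ?case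
      by (auto simp: B_def g_def)
  qed (use base in simp)
  from this[of "[-m..m]"] have "AE \<omega> in M. \<bar>iter_avg M As X \<omega> - g \<omega>\<bar> \<le> 1 / real n"
    by (simp add: As_def iter_avg_append)
  then have "AE \<omega> in M. \<bar>iter_avg M As X \<omega> - X \<omega>\<bar> \<le> 2 / real n"
  proof eventually_elim
    case (elim \<omega>)
    have "2 / real n = 1 / real n + 1 / real n" by simp
    with elim gX[of \<omega>] show ?case by linarith
  qed
  with \<open>As \<in> covers M\<close> show ?thesis by (rule that)
qed

text \<open>Convexity and law invariance put all means of copies of X below \<open>f X\<close>, and
  the Fatou property passes this to their limit. Both spaces are treated at once: the bounded case
  serves the construction of the extension, the Orlicz case its uniqueness.\<close>

lemma admissible_avg_le:
  assumes orl: "orlicz \<Phi>" and na: "nonatomic M" and E: "E = Linf M \<or> E = LPhi M \<Phi>"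
    and f: "admissible M E f" and X: "X \<in> E" and A: "A \<in> events" and avgE: "avg M A X \<in> E"
  shows "f (avg M A X) \<le> f X"
proof (cases "prob A = 0")
  interpret orlicz \<Phi> by fact
  have X_meas: "X \<in> borel_measurable M"
    using E X by (auto simp: Linf_def LPhi_def)
  case True
  then have "AE \<omega> in M. \<omega> \<notin> A"
    using A by (intro AE_not_in) (auto simp: null_sets_def emeasure_eq_measure)
  then have "AE \<omega> in M. avg M A X \<omega> = X \<omega>"
    by eventually_elim (simp add: avg_def)
  then have "distr M borel (avg M A X) = distr M borel X"
    using A X_meas by (intro distr_cong_AE) auto
  then show ?thesis
    using admissible_law[OF f avgE X] by simp
next
  interpret orlicz \<Phi> by fact
  case False
  then have pA: "prob A > 0" by (simp add: zero_less_measure_iff)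
  have XL: "X \<in> LPhi M \<Phi>"
    using E X Linf_subset_LPhi[OF orl] by auto
  obtain m :: "nat \<Rightarrow> nat" and Xs :: "nat \<Rightarrow> nat \<Rightarrow> 'a \<Rightarrow> real" and D
    where m: "\<And>k. m k > 0" and Xs_meas: "\<And>k j. j < m k \<Longrightarrow> Xs k j \<in> borel_measurable M"
      and Xs_distr: "\<And>k j. j < m k \<Longrightarrow> distr M borel (Xs k j) = distr M borel X"
      and conv: "AE \<omega> in M. (\<lambda>k. (\<Sum>j<m k. Xs k j \<omega>) / real (m k)) \<longlonglongrightarrow> avg M A X \<omega>"
      and D: "D \<in> LPhi M \<Phi>" and dom: "\<And>k. AE \<omega> in M. \<bar>(\<Sum>j<m k. Xs k j \<omega>) / real (m k)\<bar> \<le> D \<omega>"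
    using averages_of_copies[OF orl na XL A pA] by blast
  define Y where "Y k \<omega> = (\<Sum>j<m k. Xs k j \<omega>) / real (m k)" for k \<omega>
  have E_convex: "(\<lambda>\<omega>. a * V \<omega> + (1 - a) * W \<omega>) \<in> E" if "V \<in> E" "W \<in> E" for V W a
    using E that by (auto intro: Linf_convex LPhi_convex)
  have Xs_E: "Xs k j \<in> E" if "j < m k" for k j
    using E X Linf_distr[OF _ Xs_meas[OF that], of X] LPhi_distr[OF _ Xs_meas[OF that], of X] Xs_distr[OF that]
    by auto
  have fXs: "f (Xs k j) = f X" if "j < m k" for k j
    using admissible_law[OF f Xs_E[OF that] X Xs_distr[OF that]] .
  have Y: "Y k \<in> E \<and> f (Y k) \<le> f X" for k
    unfolding Y_def
    using f fXs Xs_E m admissible_not_MInf[OF f X]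
    by (intro sublevel_average E_convex) (auto simp: admissible_def)
  \<comment> \<open>The majorant must lie in E itself. For bounded variables the Orlicz majorant
    \<open>D\<close> will not do; the essential bound of X, shared by all copies because it depends
    on the law only, replaces it.\<close>
  obtain D' where D': "D' \<in> E" "\<And>k. AE \<omega> in M. \<bar>Y k \<omega>\<bar> \<le> D' \<omega>"
  proof (cases "E = LPhi M \<Phi>")
    case True
    with D dom show ?thesis by (intro that[of D]) (auto simp: Y_def)
  next
    case False
    with E have EL: "E = Linf M" by simp
    obtain C where X_meas: "X \<in> borel_measurable M" and C: "AE x in M. \<bar>X x\<bar> \<le> C"
      using X EL by (auto simp: Linf_def)
    have "AE \<omega> in M. \<bar>Y k \<omega>\<bar> \<le> C" for k
    proof -
      have "AE \<omega> in M. \<bar>Xs k j \<omega>\<bar> \<le> C" if "j < m k" for j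
      proof -
        have "AE x in distr M borel X. \<bar>x\<bar> \<le> C"
          using C X_meas by (subst AE_distr_iff) auto
        then show ?thesis
          unfolding Xs_distr[OF that, symmetric] using Xs_meas[OF that] by (subst (asm) AE_distr_iff) auto
      qed
      then have "AE \<omega> in M. \<forall>j\<in>{..<m k}. \<bar>Xs k j \<omega>\<bar> \<le> C"
        by (intro AE_finite_allI) auto
      then show ?thesis
      proof eventually_elim
        case (elim \<omega>)
        have "\<bar>\<Sum>j<m k. Xs k j \<omega>\<bar> \<le> (\<Sum>j<m k. C)"
          using elim by (intro order_trans[OF sum_abs] sum_mono) auto
        then show ?case
          using m[of k] by (simp add: Y_def abs_divide field_simps)
      qed
    qed
    then show ?thesis
      by (intro that[of "\<lambda>_. C"]) (auto simp: EL Linf_def)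
  qed
  have "f (avg M A X) \<le> liminf (\<lambda>k. f (Y k))"
    using Y D' conv by (intro admissible_fatou[OF f _ avgE D'(1)]) (auto simp: Y_def)
  also have "\<dots> \<le> f X"
    using Y by (intro liminf_le_SUP) auto
  finally show ?thesis .
qed

section \<open>Values under compositions of averages; uniqueness and existence of the
  extension\<close>

lemma iter_avg_le:
  assumes orl: "orlicz \<Phi>" and na: "nonatomic M" and f: "admissible M (Linf M) f"
    and X: "X \<in> Linf M" and As: "set As \<subseteq> events"
  shows "iter_avg M As X \<in> Linf M \<and> f (iter_avg M As X) \<le> f X"
  using As
proof (induction As)
  case (Cons A As)
  then have IH: "iter_avg M As X \<in> Linf M" "f (iter_avg M As X) \<le> f X" and A: "A \<in> events"
    by auto
  note avgL = avg_Linf[OF IH(1) A]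
  have "f (avg M A (iter_avg M As X)) \<le> f (iter_avg M As X)"
    by (rule admissible_avg_le[OF orl na _ f IH(1) A avgL]) simp
  with IH avgL show ?case by auto
qed (use X in simp)

text \<open>This gives uniqueness, since the right-hand side evaluates f at bounded variables only.
  Taking the supremum over all n makes it irrelevant along which subsequence the tail averages are
  dominated, and no monotonicity in n is used.\<close>

lemma admissible_LPhi_eq:
  assumes orl: "orlicz \<Phi>" and na: "nonatomic M" and f: "admissible M (LPhi M \<Phi>) f"
    and X: "X \<in> LPhi M \<Phi>"
  shows "f X = (SUP n. f (tail_avg M n X))"
proof (rule antisym)
  interpret orlicz \<Phi> by fact
  note X_meas = LPhi_measurable[OF X]
  have tL: "tail_avg M n X \<in> LPhi M \<Phi>" for n
    using tail_avg_Linf[OF X_meas] Linf_subset_LPhi[OF orl] by auto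
  obtain r :: "nat \<Rightarrow> nat" and D where D: "D \<in> LPhi M \<Phi>"
    "AE \<omega> in M. (\<lambda>k. tail_avg M (r k) X \<omega>) \<longlonglongrightarrow> X \<omega>"
    "\<And>k. AE \<omega> in M. \<bar>tail_avg M (r k) X \<omega>\<bar> \<le> D \<omega>"
    by (rule tail_avg_approx[OF orl X]) blast
  have "f X \<le> liminf (\<lambda>k. f (tail_avg M (r k) X))"
    by (rule admissible_fatou[OF f tL X D])
  also have "\<dots> \<le> (SUP n. f (tail_avg M n X))"
    by (intro liminf_le_SUP SUP_upper) auto
  finally show "f X \<le> (SUP n. f (tail_avg M n X))" .
  show "(SUP n. f (tail_avg M n X)) \<le> f X"
  proof (rule SUP_least)
    fix n
    show "f (tail_avg M n X) \<le> f X"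
      unfolding tail_avg_def
      by (rule admissible_avg_le[OF orl na _ f X]) (use X_meas tL[of n] in \<open>auto simp: tail_avg_def\<close>)
  qed
qed

text \<open>Each cover contributes a convex functional with the Fatou property, because its
  composition of averages is linear and respects dominated convergence; both properties pass to
  suprema. The tail formula is exported as well: it yields law invariance here and is what
  uniqueness compares with.\<close>

lemma admissible_extension:
  assumes orl: "orlicz \<Phi>" and na: "nonatomic M" and \<rho>: "admissible M (Linf M) \<rho>"
  obtains \<rho>' where "\<And>X. X \<in> Linf M \<Longrightarrow> \<rho>' X = \<rho> X" "admissible M (LPhi M \<Phi>) \<rho>'"
    "\<And>X. X \<in> LPhi M \<Phi> \<Longrightarrow> \<rho>' X = (SUP n. \<rho> (tail_avg M n X))"
proof -
  interpret orlicz \<Phi> by fact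
  define \<rho>' where "\<rho>' X = (SUP As\<in>covers M. \<rho> (iter_avg M As X))" for X
  have covers: "set As \<subseteq> events" if "As \<in> covers M" for As
    using that by (simp add: covers_def)
  have \<rho>'_upper: "\<rho> (iter_avg M As X) \<le> \<rho>' X" if "As \<in> covers M" for As X
    unfolding \<rho>'_def using that by (rule SUP_upper)
  \<comment> \<open>A cover sends even the unbounded majorant Y to a bounded variable, so domination
    in the Orlicz space becomes domination in the domain of \<rho>.\<close>
  have iter_fatou: "\<rho> (iter_avg M As X) \<le> liminf (\<lambda>n. \<rho> (iter_avg M As (Xs n)))"
    if As: "As \<in> covers M" and Xs: "\<And>n. Xs n \<in> borel_measurable M" and X: "X \<in> borel_measurable M"
      and Y: "Y \<in> LPhi M \<Phi>" and conv: "AE \<omega> in M. (\<lambda>n. Xs n \<omega>) \<longlonglongrightarrow> X \<omega>"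
      and dom: "\<And>n. AE \<omega> in M. \<bar>Xs n \<omega>\<bar> \<le> Y \<omega>" for As Xs X Y
    using iter_avg_dominated[OF Xs X LPhi_integrable[OF orl Y] conv dom covers[OF As]]
    by (intro admissible_fatou[OF \<rho>, where Y = "iter_avg M As Y"] iter_avg_Linf Xs X LPhi_measurable[OF Y] As) auto
  have ext: "\<rho>' X = \<rho> X" if X: "X \<in> Linf M" for X
  proof (rule antisym)
    show "\<rho>' X \<le> \<rho> X"
      unfolding \<rho>'_def using iter_avg_le[OF orl na \<rho> X covers] by (intro SUP_least) auto
    \<comment> \<open>Covers with uniform error 2 / (n + 1) give a sequence tending to X and bounded
      by C + 2, to which the Fatou property of \<rho> applies.\<close>
    have "\<exists>As. As \<in> covers M \<and> (AE \<omega> in M. \<bar>iter_avg M As X \<omega> - X \<omega>\<bar> \<le> 2 / real (Suc n))" for n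
      by (rule iter_avg_near[OF X zero_less_Suc[of n]]) blast
    then obtain As where As: "\<And>n. As n \<in> covers M"
      "\<And>n. AE \<omega> in M. \<bar>iter_avg M (As n) X \<omega> - X \<omega>\<bar> \<le> 2 / real (Suc n)"
      by metis
    obtain C where X_meas: "X \<in> borel_measurable M" and C: "AE x in M. \<bar>X x\<bar> \<le> C"
      using X by (auto simp: Linf_def)
    have "AE \<omega> in M. (\<lambda>n. iter_avg M (As n) X \<omega>) \<longlonglongrightarrow> X \<omega>"
    proof -
      have "AE \<omega> in M. \<forall>n. \<bar>iter_avg M (As n) X \<omega> - X \<omega>\<bar> \<le> 2 / real (Suc n)"
        using As(2) by (simp add: AE_all_countable)
      then show ?thesis
      proof eventually_elim
        case (elim \<omega>)
        have lim: "(\<lambda>n. 2 / real (Suc n)) \<longlonglongrightarrow> 0" by real_asymp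
        have "(\<lambda>n. iter_avg M (As n) X \<omega> - X \<omega>) \<longlonglongrightarrow> 0"
          by (rule Lim_null_comparison[OF _ lim]) (use elim in auto)
        then show ?case by (simp add: LIM_zero_iff)
      qed
    qed
    moreover have "AE \<omega> in M. \<bar>iter_avg M (As n) X \<omega>\<bar> \<le> C + 2" for n
      using As(2)[of n] C
    proof eventually_elim
      case (elim \<omega>)
      have "2 / real (Suc n) \<le> 2" by (simp add: field_simps)
      with elim show ?case by linarith
    qed
    moreover have "(\<lambda>_. C + 2) \<in> Linf M"
      by (auto simp: Linf_def)
    ultimately have "\<rho> X \<le> liminf (\<lambda>n. \<rho> (iter_avg M (As n) X))"
      by (intro admissible_fatou[OF \<rho> iter_avg_Linf[OF X_meas As(1)] X, where Y = "\<lambda>_. C + 2"]) auto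
    also have "\<dots> \<le> \<rho>' X"
      using \<rho>'_upper As(1) by (intro liminf_le_SUP) auto
    finally show "\<rho> X \<le> \<rho>' X" .
  qed
  have key: "\<rho>' X = (SUP n. \<rho> (tail_avg M n X))" if X: "X \<in> LPhi M \<Phi>" for X
  proof (rule antisym)
    note X_meas[measurable] = LPhi_measurable[OF X]
    obtain r :: "nat \<Rightarrow> nat" and D where D: "D \<in> LPhi M \<Phi>"
      "AE \<omega> in M. (\<lambda>k. tail_avg M (r k) X \<omega>) \<longlonglongrightarrow> X \<omega>"
      "\<And>k. AE \<omega> in M. \<bar>tail_avg M (r k) X \<omega>\<bar> \<le> D \<omega>"
      by (rule tail_avg_approx[OF orl X]) blast
    show "\<rho>' X \<le> (SUP n. \<rho> (tail_avg M n X))"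
      unfolding \<rho>'_def
    proof (rule SUP_least)
      fix As assume As: "As \<in> covers M"
      have "\<rho> (iter_avg M As X) \<le> liminf (\<lambda>k. \<rho> (iter_avg M As (tail_avg M (r k) X)))"
        by (rule iter_fatou[OF As _ X_meas D]) measurable
      also have "\<dots> \<le> (SUP n. \<rho> (tail_avg M n X))"
      proof (rule liminf_le_SUP)
        fix k
        have "\<rho> (iter_avg M As (tail_avg M (r k) X)) \<le> \<rho> (tail_avg M (r k) X)"
          using iter_avg_le[OF orl na \<rho> tail_avg_Linf[OF X_meas] covers[OF As]] by simp
        also have "\<dots> \<le> (SUP n. \<rho> (tail_avg M n X))"
          by (rule SUP_upper) simp
        finally show "\<rho> (iter_avg M As (tail_avg M (r k) X)) \<le> (SUP n. \<rho> (tail_avg M n X))" .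
      qed
      finally show "\<rho> (iter_avg M As X) \<le> (SUP n. \<rho> (tail_avg M n X))" .
    qed
    show "(SUP n. \<rho> (tail_avg M n X)) \<le> \<rho>' X"
    proof (rule SUP_least)
      fix n
      \<comment> \<open>The tail average is bounded, so agreement with \<rho> on bounded variables
        rewrites its value as a supremum over covers; each term is then a term for X itself.\<close>
      have "\<rho> (tail_avg M n X) = (SUP As\<in>covers M. \<rho> (iter_avg M As (tail_avg M n X)))"
        using ext[OF tail_avg_Linf[OF X_meas], of n] by (simp add: \<rho>'_def)
      also have "\<dots> \<le> \<rho>' X"
      proof (rule SUP_least)
        fix As assume As: "As \<in> covers M"
        have "tail M n X \<in> events" by measurable
        \<comment> \<open>Overlap with the events of \<open>As\<close> is harmless, so the enlarged
          list is a cover without further adjustment.\<close>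
        with As sets.sets_into_space[OF this] have "As @ [tail M n X] \<in> covers M"
          by (auto simp: covers_def)
        from \<rho>'_upper[OF this, of X] show "\<rho> (iter_avg M As (tail_avg M n X)) \<le> \<rho>' X"
          by (simp add: iter_avg_append tail_avg_def)
      qed
      finally show "\<rho> (tail_avg M n X) \<le> \<rho>' X" .
    qed
  qed
  have "proper_on (LPhi M \<Phi>) \<rho>'"
    unfolding proper_on_def
  proof (intro conjI ballI)
    fix X assume X: "X \<in> LPhi M \<Phi>"
    \<comment> \<open>A single term of the supremum above -\<infinity> suffices; this one replaces X
      by its expectation.\<close>
    have cov: "[space M] \<in> covers M" by (auto simp: covers_def)
    have "\<rho> (iter_avg M [space M] X) \<noteq> -\<infinity>"
      by (rule admissible_not_MInf[OF \<rho> iter_avg_Linf[OF LPhi_measurable[OF X] cov]])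
    with \<rho>'_upper[OF cov, of X] show "\<rho>' X \<noteq> -\<infinity>" by auto
  next
    obtain X where "X \<in> Linf M" "\<rho> X \<noteq> \<infinity>"
      using \<rho> by (auto simp: admissible_def proper_on_def)
    then show "\<exists>X\<in>LPhi M \<Phi>. \<rho>' X \<noteq> \<infinity>"
      using Linf_subset_LPhi[OF orl] ext by (intro bexI[of _ X]) auto
  qed
  moreover have "convex_fun_on (LPhi M \<Phi>) \<rho>'"
    unfolding convex_fun_on_def
  proof (intro ballI allI impI)
    fix X Y and a :: real
    assume X: "X \<in> LPhi M \<Phi>" and Y: "Y \<in> LPhi M \<Phi>" and a: "0 \<le> a \<and> a \<le> 1"
    show "\<rho>' (\<lambda>\<omega>. a * X \<omega> + (1 - a) * Y \<omega>) \<le> ereal a * \<rho>' X + ereal (1 - a) * \<rho>' Y"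
      unfolding \<rho>'_def[of "\<lambda>\<omega>. a * X \<omega> + (1 - a) * Y \<omega>"]
    proof (rule SUP_least)
      fix As assume As: "As \<in> covers M"
      have "\<rho> (iter_avg M As (\<lambda>\<omega>. a * X \<omega> + (1 - a) * Y \<omega>))
          = \<rho> (\<lambda>\<omega>. a * iter_avg M As X \<omega> + (1 - a) * iter_avg M As Y \<omega>)"
        using LPhi_integrable[OF orl X] LPhi_integrable[OF orl Y] covers[OF As] by (simp add: iter_avg_linear)
      also have "\<dots> \<le> ereal a * \<rho> (iter_avg M As X) + ereal (1 - a) * \<rho> (iter_avg M As Y)"
        using a by (intro admissible_convex[OF \<rho>] iter_avg_Linf LPhi_measurable[OF X] LPhi_measurable[OF Y] As) auto
      also have "\<dots> \<le> ereal a * \<rho>' X + ereal (1 - a) * \<rho>' Y"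
        using a by (intro add_mono ereal_mult_left_mono \<rho>'_upper As) auto
      finally show "\<rho> (iter_avg M As (\<lambda>\<omega>. a * X \<omega> + (1 - a) * Y \<omega>)) \<le> ereal a * \<rho>' X + ereal (1 - a) * \<rho>' Y" .
    qed
  qed
  moreover have "law_invariant_on M (LPhi M \<Phi>) \<rho>'"
    unfolding law_invariant_on_def
  proof (intro ballI impI)
    fix X Y assume X: "X \<in> LPhi M \<Phi>" and Y: "Y \<in> LPhi M \<Phi>" and eq: "distr M borel X = distr M borel Y"
    \<comment> \<open>Individual covers need not respect equality in law, so the tail formula is
      used here.\<close>
    have "\<rho> (tail_avg M n X) = \<rho> (tail_avg M n Y)" for n
      by (intro admissible_law[OF \<rho>] tail_avg_Linf tail_avg_distr LPhi_measurable[OF X] LPhi_measurable[OF Y] eq)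
    then show "\<rho>' X = \<rho>' Y" by (simp add: key X Y)
  qed
  moreover have "fatou_on M (LPhi M \<Phi>) \<rho>'"
    unfolding fatou_on_def
  proof (intro allI impI, elim conjE)
    fix Xs X Y
    assume Xs: "\<forall>n. Xs n \<in> LPhi M \<Phi>" and X: "X \<in> LPhi M \<Phi>" and Y: "Y \<in> LPhi M \<Phi>"
      and conv: "AE \<omega> in M. (\<lambda>n. Xs n \<omega>) \<longlonglongrightarrow> X \<omega>" and dom: "\<forall>n. AE \<omega> in M. \<bar>Xs n \<omega>\<bar> \<le> Y \<omega>"
    show "\<rho>' X \<le> liminf (\<lambda>n. \<rho>' (Xs n))"
      unfolding \<rho>'_def[of X]
    proof (rule SUP_least)
      fix As assume As: "As \<in> covers M"
      have "\<rho> (iter_avg M As X) \<le> liminf (\<lambda>n. \<rho> (iter_avg M As (Xs n)))"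
        using Xs dom by (intro iter_fatou[OF As _ LPhi_measurable[OF X] Y conv] LPhi_measurable) auto
      also have "\<dots> \<le> liminf (\<lambda>n. \<rho>' (Xs n))"
        by (intro Liminf_mono always_eventually allI \<rho>'_upper As)
      finally show "\<rho> (iter_avg M As X) \<le> liminf (\<lambda>n. \<rho>' (Xs n))" .
    qed
  qed
  ultimately have "admissible M (LPhi M \<Phi>) \<rho>'" by (simp add: admissible_def)
  from that[OF ext this key] show ?thesis .
qed

end

theorem theorem4:
  fixes M :: "'a measure" and \<Phi> :: "real \<Rightarrow> real" and \<rho> :: "('a \<Rightarrow> real) \<Rightarrow> ereal"
  assumes "prob_space M" and "nonatomic M"
    and "standing_orlicz \<Phi>"
    and "proper_on (Linf M) \<rho>" and "convex_fun_on (Linf M) \<rho>"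
    and "law_invariant_on M (Linf M) \<rho>" and "fatou_on M (Linf M) \<rho>"
  shows "\<exists>\<rho>'. (\<forall>X\<in>Linf M. \<rho>' X = \<rho> X)
      \<and> proper_on (LPhi M \<Phi>) \<rho>' \<and> convex_fun_on (LPhi M \<Phi>) \<rho>'
      \<and> law_invariant_on M (LPhi M \<Phi>) \<rho>' \<and> fatou_on M (LPhi M \<Phi>) \<rho>'
      \<and> (\<forall>\<rho>''. (\<forall>X\<in>Linf M. \<rho>'' X = \<rho> X)
            \<and> proper_on (LPhi M \<Phi>) \<rho>'' \<and> convex_fun_on (LPhi M \<Phi>) \<rho>''
            \<and> law_invariant_on M (LPhi M \<Phi>) \<rho>'' \<and> fatou_on M (LPhi M \<Phi>) \<rho>''
          \<longrightarrow> (\<forall>X\<in>LPhi M \<Phi>. \<rho>'' X = \<rho>' X))"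
proof -
  interpret prob_space M by fact
  interpret orlicz \<Phi> using assms(3) by unfold_locales
  have "admissible M (Linf M) \<rho>"
    using assms by (simp add: admissible_def)
  then obtain \<rho>' where ext: "\<And>X. X \<in> Linf M \<Longrightarrow> \<rho>' X = \<rho> X" and adm: "admissible M (LPhi M \<Phi>) \<rho>'"
    and \<rho>': "\<And>X. X \<in> LPhi M \<Phi> \<Longrightarrow> \<rho>' X = (SUP n. \<rho> (tail_avg M n X))"
    using admissible_extension[OF orlicz_axioms \<open>nonatomic M\<close>] by metis
  \<comment> \<open>Both functionals equal the supremum of \<rho> over the same bounded tail
    averages.\<close>
  have "\<rho>'' X = \<rho>' X" if "\<forall>X\<in>Linf M. \<rho>'' X = \<rho> X" "admissible M (LPhi M \<Phi>) \<rho>''" "X \<in> LPhi M \<Phi>" for \<rho>'' X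
    using admissible_LPhi_eq[OF orlicz_axioms \<open>nonatomic M\<close> that(2,3)] \<rho>'[OF that(3)] that(1)
      tail_avg_Linf[OF LPhi_measurable[OF that(3)]] by simp
  with ext adm show ?thesis
    unfolding admissible_def by (intro exI[of _ \<rho>']) auto
qed

end
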